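(* Let $V : \mathbb{R}^n \to \mathbb{R}$ be a twice differentiable function with a locally Lipschitz Hessian, and let $y : \mathbb{R}^+ \to \mathbb{R}^n$ be an absolutely continuous trajectory (so that $\dot y(t)$ exists for almost every $t$). Suppose that at every $t \ge 0$ where $\dot y(t)$ exists, $\dot{y}_i(t)\, \frac{\partial V}{\partial x_i}(y(t)) \leq 0$ for all $i = 1, \ldots, n$. If $\nabla^2 V(x) \succ 0$ for all $x \in \mathbb{R}^n$ and $V$ admits a minimum $x^*$, then $y(t)$ converges to a point of $\mathbb{R}^n$ as $t \to \infty$. Hence, if $V$ is strongly convex, then $y(t)$ converges to a point of $\mathbb{R}^n$ as $t\to\infty$.
   Context: $\mathbb{R}^+ = [0,\infty)$. $A \succ 0$ means that the symmetric matrix $A$ is positive definite. *)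

theory Defs
  imports "HOL-Analysis.Analysis"
begin

definition partial_derivative :: "'n::finite \<Rightarrow> (real ^ 'n \<Rightarrow> real) \<Rightarrow> real ^ 'n \<Rightarrow> real" where
  "partial_derivative i V x = deriv (\<lambda>s. V (x + s *\<^sub>R axis i 1)) 0"

definition gradient :: "(real ^ 'n::finite \<Rightarrow> real) \<Rightarrow> real ^ 'n \<Rightarrow> real ^ 'n" where
  "gradient V x = (\<chi> i. partial_derivative i V x)"

definition hessian :: "(real ^ 'n::finite \<Rightarrow> real) \<Rightarrow> real ^ 'n \<Rightarrow> real ^ 'n ^ 'n" where
  "hessian V x = (\<chi> i j. partial_derivative j (partial_derivative i V) x)"

text \<open>Differentiability is total (Frechet) differentiability; by itself, existence of the
  partial derivatives entering \<open>gradient\<close> and \<open>hessian\<close> would be weaker.\<close>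

definition twice_differentiable :: "(real ^ 'n::finite \<Rightarrow> real) \<Rightarrow> bool" where
  "twice_differentiable V \<longleftrightarrow>
     (\<forall>x. V differentiable (at x)) \<and> (\<forall>x. gradient V differentiable (at x))"

definition locally_lipschitz :: "('a::metric_space \<Rightarrow> 'b::metric_space) \<Rightarrow> bool" where
  "locally_lipschitz f \<longleftrightarrow> (\<forall>x. \<exists>u>0. \<exists>L. L-lipschitz_on (cball x u) f)"

definition positive_definite :: "real ^ 'n::finite ^ 'n \<Rightarrow> bool" where
  "positive_definite A \<longleftrightarrow> transpose A = A \<and> (\<forall>v. v \<noteq> 0 \<longrightarrow> 0 < v \<bullet> (A *v v))"

definition strongly_convex :: "('a::real_normed_vector \<Rightarrow> real) \<Rightarrow> bool" where
  "strongly_convex V \<longleftrightarrow> (\<exists>\<mu>>0. \<forall>x y. \<forall>\<theta>\<in>{0..1}.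
     V (\<theta> *\<^sub>R x + (1 - \<theta>) *\<^sub>R y)
       \<le> \<theta> * V x + (1 - \<theta>) * V y - \<mu> / 2 * \<theta> * (1 - \<theta>) * (norm (x - y))\<^sup>2)"

text \<open>The usual \<open>\<epsilon>\<close>-\<open>\<delta>\<close> condition; a finite family of non-overlapping closed intervals is a
  finite set of endpoint pairs. Degenerate pairs contribute nothing to either sum.\<close>

definition absolutely_continuous_on :: "real set \<Rightarrow> (real \<Rightarrow> 'a::metric_space) \<Rightarrow> bool" where
  "absolutely_continuous_on S f \<longleftrightarrow> (\<forall>\<epsilon>>0. \<exists>\<delta>>0. \<forall>D.
     finite D \<and> (\<forall>(a, b)\<in>D. a \<le> b \<and> {a..b} \<subseteq> S) \<and>
     disjoint_family_on (\<lambda>(a, b). {a<..<b}) D \<and> (\<Sum>(a, b)\<in>D. b - a) < \<delta>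
     \<longrightarrow> (\<Sum>(a, b)\<in>D. dist (f a) (f b)) < \<epsilon>)"

text \<open>As usual for trajectories on the unbounded interval \<open>[0, \<infinity>)\<close>, absolute continuity is
  required on compact subintervals. This is implied by (and weaker than) the
  \<open>\<epsilon>\<close>-\<open>\<delta>\<close> condition on all of \<open>[0, \<infinity>)\<close>.\<close>

definition absolutely_continuous_trajectory :: "(real \<Rightarrow> 'a::metric_space) \<Rightarrow> bool" where
  "absolutely_continuous_trajectory y \<longleftrightarrow> (\<forall>T\<ge>0. absolutely_continuous_on {0..T} y)"

end

theory Submission
  imports Defs
begin

text \<open>Absolute continuity makes \<open>y\<close> differentiable almost everywhere, so \<open>V \<circ> y\<close> is nonincreasing;
  sublevel sets of \<open>V\<close> being bounded, \<open>y\<close> has a limit point \<open>l\<close>, and \<open>V (y t) \<ge> V l\<close> throughout.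
  Put \<open>g = \<nabla>V l\<close>. Near \<open>l\<close> each component of \<open>2 \<nabla>V - g\<close> either is twice that of \<open>\<nabla>V\<close> (where
  \<open>g\<close> vanishes) or has the same sign as that of \<open>\<nabla>V\<close>, so the coordinatewise sign condition makes
  \<open>L x = 2 V x - g \<bullet> x\<close> nonincreasing along \<open>y\<close> while \<open>y\<close> stays near \<open>l\<close>. As
  \<open>L x - L l = (V x - V l) + (V x - V l - g \<bullet> (x - l))\<close>, strict convexity bounds \<open>L - L l\<close> below by a
  positive constant on the part of a small sphere about \<open>l\<close> where \<open>V \<ge> V l\<close>. Once \<open>y\<close> is close
  enough to \<open>l\<close>, it can therefore never cross that sphere.\<close>

subsection \<open>Functions of bounded variation are differentiable almost everywhere\<close>

abbreviation incr :: "(real \<Rightarrow> real) \<Rightarrow> real set \<Rightarrow> real" where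
  "incr f K \<equiv> f (Sup K) - f (Inf K)"

lemma sum_incr_division:
  assumes "a \<le> b" "d division_of {a..b}"
  shows "(\<Sum>K\<in>d. incr f K) = f b - f a"
proof -
  \<comment> \<open>Telescoping is available for tagged divisions. The tag has no influence on the
    sum; the left endpoint is a point that every cell contains.\<close>
  let ?p = "(\<lambda>K. (Inf K, K)) ` d"
  have mem: "Inf K \<in> K" if "K \<in> d" for K
    using division_ofD(3,4)[OF assms(2) that] by (auto simp: cbox_interval)
  have "?p tagged_division_of {a..b}"
    unfolding tagged_division_of
  proof (intro conjI allI impI)
    show "finite ?p" using division_ofD(1)[OF assms(2)] by simp
    show "\<Union>{K. \<exists>x. (x, K) \<in> ?p} = {a..b}"
      using division_ofD(6)[OF assms(2)] by (simp add: image_iff Union_eq Bex_def)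
    show "interior K1 \<inter> interior K2 = {}"
      if "(x1, K1) \<in> ?p \<and> (x2, K2) \<in> ?p \<and> (x1, K1) \<noteq> (x2, K2)" for x1 K1 x2 K2
      using that by (intro division_ofD(5)[OF assms(2)]) auto
  qed (use division_ofD(2,4)[OF assms(2)] mem in auto)
  from additive_tagged_division_1[OF assms(1) this, of f]
  show ?thesis
    by (subst (asm) sum.reindex) (auto simp: inj_on_def o_def)
qed

text \<open>Vitali's covering theorem picks countably many disjoint intervals with \<open>P\<close>
  that cover \<open>S - N\<close> up to a null set. The bound on finite disjoint families passes to
  their countable union, and null sets add nothing. The set \<open>N\<close> leaves room for points,
  such as division points, around which no interval with \<open>P\<close> can be found.\<close>

lemma vitali_outer_measure_le:
  fixes P :: "real \<Rightarrow> real \<Rightarrow> bool"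
  assumes N: "negligible N"
    and P: "\<And>u v. P u v \<Longrightarrow> u < v"
    and cover: "\<And>x d. x \<in> S - N \<Longrightarrow> 0 < d \<Longrightarrow> \<exists>u v. P u v \<and> x \<in> {u..v} \<and> v - u < d"
    and small: "\<And>D. finite D \<Longrightarrow> (\<And>u v. (u, v) \<in> D \<Longrightarrow> P u v) \<Longrightarrow>
      pairwise (\<lambda>i j. disjnt {fst i..snd i} {fst j..snd j}) D \<Longrightarrow> (\<Sum>(u, v)\<in>D. v - u) \<le> e"
  shows "\<exists>T. S \<subseteq> T \<and> T \<in> lmeasurable \<and> measure lebesgue T \<le> e"
proof -
  let ?a = "\<lambda>(u, v). (u + v) / 2 :: real" and ?r = "\<lambda>(u, v). (v - u) / 2 :: real"
  have cb: "cball (?a i) (?r i) = {fst i..snd i}" for i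
    by (cases i) (simp add: cball_eq_atLeastAtMost field_simps)
  obtain C where C: "countable C" "C \<subseteq> {(u, v). P u v}"
      "pairwise (\<lambda>i j. disjnt (cball (?a i) (?r i)) (cball (?a j) (?r j))) C"
      "negligible (S - N - (\<Union>i\<in>C. cball (?a i) (?r i)))"
  proof (rule Vitali_covering_theorem_cballs[of "{(u, v). P u v}" ?r "S - N" ?a])
    show "0 < ?r i" if "i \<in> {(u, v). P u v}" for i
      using that P by auto
    show "\<exists>i. i \<in> {(u, v). P u v} \<and> x \<in> cball (?a i) (?r i) \<and> ?r i < d" if "x \<in> S - N" "0 < d" for x d
    proof -
      have "\<exists>u v. P u v \<and> x \<in> {u..v} \<and> v - u < d"
        using cover that by blast
      then obtain u v where "P u v" "x \<in> {u..v}" "v - u < d" by blast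
      then show ?thesis
        using P[of u v] unfolding cb by (intro exI[of _ "(u, v)"]) auto
    qed
  qed blast
  let ?U = "\<Union>i\<in>C. {fst i..snd i}"
  have fin: "measure lebesgue (\<Union>i\<in>F. {fst i..snd i}) \<le> e" if F: "F \<subseteq> C" "finite F" for F
  proof -
    have "measure lebesgue (\<Union>i\<in>F. {fst i..snd i}) \<le> (\<Sum>i\<in>F. measure lebesgue {fst i..snd i})"
      using F by (intro measure_UNION_le) auto
    also have "\<dots> = (\<Sum>(u, v)\<in>F. v - u)"
    proof (rule sum.cong)
      fix i assume "i \<in> F"
      then have "fst i < snd i" using F C(2) P by force
      then show "measure lebesgue {fst i..snd i} = (case i of (u, v) \<Rightarrow> v - u)"
        by (auto simp: case_prod_beta)
    qed simp
    also have "\<dots> \<le> e"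
      using F C(2,3) unfolding cb by (intro small) (auto intro: pairwise_subset)
    finally show ?thesis .
  qed
  have U: "?U \<in> lmeasurable \<and> measure lebesgue ?U \<le> e"
    using fmeasurable_UN_bound[of C "\<lambda>i. {fst i..snd i}" lebesgue e]
      measure_UN_bound[of C "\<lambda>i. {fst i..snd i}" lebesgue e] C(1) fin by auto
  let ?R = "(S - N - ?U) \<union> N"
  have R: "negligible ?R"
    using C(4) N unfolding cb by simp
  show ?thesis
  proof (intro exI conjI)
    show "S \<subseteq> ?U \<union> ?R" by blast
    show "?U \<union> ?R \<in> lmeasurable"
      using U R negligible_imp_measurable by (intro fmeasurable.Un) auto
    show "measure lebesgue (?U \<union> ?R) \<le> e"
      using U R measure_Un_null_set[of ?U lebesgue ?R] by (auto simp: negligible_iff_null_sets)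
  qed
qed

text \<open>The increments over \<open>q\<close> add up to the increment over \<open>{u..v}\<close>,
  whose sign is \<open>s\<close>. The cells of \<open>F\<close> contribute at most
  \<open>- \<alpha>\<close> times their length in direction \<open>s\<close>, so the other cells
  must make up for this loss. Their variation alone already exceeds
  \<open>\<bar>incr f {u..v}\<bar>\<close> by the stated amount.\<close>

lemma division_refine_incr:
  fixes f :: "real \<Rightarrow> real"
  assumes uv: "u \<le> v" and F: "F division_of \<Union>F" "\<Union>F \<subseteq> {u..v}"
    and s: "\<bar>s\<bar> = 1" "0 \<le> s * incr f {u..v}"
    and slope: "\<And>K. K \<in> F \<Longrightarrow> \<alpha> * measure lborel K \<le> - s * incr f K"
  obtains q where "q division_of {u..v}"
    "\<bar>incr f {u..v}\<bar> + \<alpha> * (\<Sum>K\<in>F. measure lborel K) \<le> (\<Sum>K\<in>q. \<bar>incr f K\<bar>)"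
proof -
  obtain q where q: "F \<subseteq> q" "q division_of {u..v}"
    using partial_division_extend_interval[of F u v] F by (auto simp: cbox_interval)
  have fq: "finite q" using q(2) by auto
  have s_le: "s * x \<le> \<bar>x\<bar>" for x
    using s(1) by (metis abs_ge_self abs_mult mult_1)
  have "\<bar>incr f {u..v}\<bar> = s * incr f {u..v}"
    using s by (metis abs_mult abs_of_nonneg mult_1)
  also have "\<dots> = s * (\<Sum>K\<in>q. incr f K)"
    using sum_incr_division[OF uv q(2), of f] uv by simp
  also have "\<dots> = (\<Sum>K\<in>q - F. s * incr f K) + (\<Sum>K\<in>F. s * incr f K)"
    using sum.subset_diff[OF q(1) fq, of "\<lambda>K. s * incr f K"] by (simp add: sum_distrib_left)
  also have "\<dots> \<le> (\<Sum>K\<in>q - F. \<bar>incr f K\<bar>) + (\<Sum>K\<in>F. - (\<alpha> * measure lborel K))"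
    using slope s_le by (intro add_mono sum_mono) (auto, smt (verit))
  also have "(\<Sum>K\<in>q - F. \<bar>incr f K\<bar>) \<le> (\<Sum>K\<in>q. \<bar>incr f K\<bar>)"
    using fq by (intro sum_mono2) auto
  finally show thesis
    using that[OF q(2)] by (simp add: sum_negf sum_distrib_left)
qed

lemma disjoint_intervals_division:
  fixes D :: "(real \<times> real) set"
  assumes "finite D" "\<And>u v. (u, v) \<in> D \<Longrightarrow> u < v"
    and "pairwise (\<lambda>i j. disjnt {fst i..snd i} {fst j..snd j}) D"
  shows "(\<lambda>(u, v). {u..v}) ` D division_of \<Union>((\<lambda>(u, v). {u..v}) ` D)"
    and "sum g ((\<lambda>(u, v). {u..v}) ` D) = (\<Sum>(u, v)\<in>D. g {u..v})"
proof -
  let ?F = "(\<lambda>(u, v). {u..v}) ` D"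
  have disj: "{u..v} \<inter> {u'..v'} = {}" if "(u, v) \<in> D" "(u', v') \<in> D" "(u, v) \<noteq> (u', v')" for u v u' v'
    using assms(3) that unfolding pairwise_def disjnt_def by fastforce
  show "?F division_of \<Union>?F"
  proof (rule division_ofI)
    fix K assume "K \<in> ?F"
    then obtain u v where K: "K = {u..v}" "(u, v) \<in> D" by auto
    then show "K \<noteq> {}" "\<exists>a b. K = cbox a b"
      using assms(2)[of u v] unfolding cbox_interval by fastforce+
  next
    fix K1 K2 assume "K1 \<in> ?F" "K2 \<in> ?F" "K1 \<noteq> K2"
    then have "K1 \<inter> K2 = {}" using disj by fastforce
    then show "interior K1 \<inter> interior K2 = {}" using interior_subset by blast
  qed (use assms(1) in auto)
  have "inj_on (\<lambda>(u, v). {u..v}) D"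
    using assms(2) by (fastforce simp: inj_on_def Icc_eq_Icc)
  then show "sum g ?F = (\<Sum>(u, v)\<in>D. g {u..v})"
    by (subst sum.reindex) (auto simp: o_def case_prod_beta)
qed

lemma division_of_real:
  fixes d :: "real set set"
  assumes "d division_of S" "K \<in> d"
  shows "K = {Inf K..Sup K}" "Inf K \<le> Sup K"
  using division_ofD(3,4)[OF assms] by (auto simp: cbox_interval)

text \<open>Divisions of two different cells can share a member only if its interior is empty. Such
  a member is a single point, on which the increment is 0, so merging the divisions into one set
  loses nothing from the sum.\<close>

lemma division_refine:
  fixes f :: "real \<Rightarrow> real"
  assumes d: "d division_of S" and q: "\<And>K. K \<in> d \<Longrightarrow> q K division_of K"
  shows "(\<Union>K\<in>d. q K) division_of S"
    and "(\<Sum>J\<in>(\<Union>K\<in>d. q K). \<bar>incr f J\<bar>) = (\<Sum>K\<in>d. \<Sum>J\<in>q K. \<bar>incr f J\<bar>)"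
proof -
  note dD = division_ofD[OF d] and qD = division_ofD[OF q]
  have disj: "interior J1 \<inter> interior J2 = {}"
    if "K1 \<in> d" "K2 \<in> d" "K1 \<noteq> K2" "J1 \<in> q K1" "J2 \<in> q K2" for K1 K2 J1 J2
    using dD(5)[OF that(1-3)] qD(2)[OF that(1,4)] qD(2)[OF that(2,5)] interior_mono by blast
  show "(\<Union>K\<in>d. q K) division_of S"
  proof (rule division_ofI)
    show "finite (\<Union>K\<in>d. q K)" using dD(1) qD(1) by blast
    show "\<Union>(\<Union>K\<in>d. q K) = S" using dD(6) qD(6) by blast
    show "interior K1 \<inter> interior K2 = {}"
      if "K1 \<in> (\<Union>K\<in>d. q K)" "K2 \<in> (\<Union>K\<in>d. q K)" "K1 \<noteq> K2" for K1 K2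
      using that disj qD(5) by (metis UN_E)
  qed (use dD(2) qD(2,3,4) in \<open>blast+\<close>)
  \<comment> \<open>A division determines its union, so \<open>K\<close> can be recovered from
    \<open>q K\<close>.\<close>
  have inj: "inj_on q d"
    using qD(6) by (metis inj_onI)
  have "(\<Sum>J\<in>\<Union>(q ` d). \<bar>incr f J\<bar>) = (sum \<circ> sum) (\<lambda>J. \<bar>incr f J\<bar>) (q ` d)"
  proof (rule sum.Union_comp)
    show "\<forall>A\<in>q ` d. finite A" using qD(1) by blast
    fix A1 A2 J assume A: "A1 \<in> q ` d" "A2 \<in> q ` d" "A1 \<noteq> A2" "J \<in> A1" "J \<in> A2"
    then obtain K1 K2 where K: "K1 \<in> d" "K2 \<in> d" "K1 \<noteq> K2" "J \<in> q K1" "J \<in> q K2" by auto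
    then have "interior J = {}" using disj[OF K] by simp
    moreover have "J = {Inf J..Sup J}" "Inf J \<le> Sup J"
      using division_of_real[OF q[OF K(1)] K(4)] .
    ultimately have "{Inf J<..<Sup J} = {}"
      by (metis interior_atLeastAtMost_real)
    then have "Inf J = Sup J" using \<open>Inf J \<le> Sup J\<close> by auto
    then show "\<bar>incr f J\<bar> = 0" by simp
  qed
  then show "(\<Sum>J\<in>(\<Union>K\<in>d. q K). \<bar>incr f J\<bar>) = (\<Sum>K\<in>d. \<Sum>J\<in>q K. \<bar>incr f J\<bar>)"
    using inj by (simp add: sum.reindex)
qed

section \<open>Null sets on which difference quotients oscillate or are unbounded\<close>

lemma steep_interval:
  fixes f :: "real \<Rightarrow> real"
  assumes "\<exists>\<^sub>F s in at t. Q ((f s - f t) / (s - t))" "0 < e"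
  obtains u v m where "u < v" "t \<in> {u..v}" "v - u < e" "Q m" "f v - f u = m * (v - u)"
proof -
  obtain s where s: "s \<noteq> t" "dist s t < e" "Q ((f s - f t) / (s - t))"
    using assms unfolding frequently_at by blast
  \<comment> \<open>The difference quotient is symmetric in \<open>s\<close> and \<open>t\<close>,
    so it is the slope over the interval between them whichever side \<open>s\<close> is on.\<close>
  have "f (max s t) - f (min s t) = (f s - f t) / (s - t) * (max s t - min s t)"
    using s(1) by (auto simp: max_def min_def field_simps)
  then show thesis
    using s by (intro that[of "min s t" "max s t"]) (auto simp: dist_real_def max_def min_def)
qed

text \<open>Austin's argument: refine a division of nearly maximal variation by short intervals around
  points of the set, on which the slope has the sign opposite to that of the surrounding cell.
  Each of them adds at least \<open>\<alpha>\<close> times its length to the variation.\<close>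

lemma negligible_oscillating_slope:
  fixes f :: "real \<Rightarrow> real"
  assumes ab: "a \<le> b" and \<alpha>: "0 < \<alpha>"
    and B: "\<And>d. d division_of {a..b} \<Longrightarrow> (\<Sum>K\<in>d. \<bar>incr f K\<bar>) \<le> B"
  shows "negligible {t \<in> {a<..<b}. (\<exists>\<^sub>F s in at t. (f s - f t) / (s - t) < - \<alpha>) \<and>
           (\<exists>\<^sub>F s in at t. \<alpha> < (f s - f t) / (s - t))}" (is "negligible ?S")
  unfolding negligible_outer_le
proof (intro allI impI)
  fix e :: real assume e: "0 < e"
  \<comment> \<open>\<open>W\<close> is the total variation. A division \<open>d\<close> whose
    variation misses it by less than \<open>\<alpha> * e\<close> can gain less than
    \<open>\<alpha> * e\<close> under refinement, which caps the total length of the opposing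
    intervals at \<open>e\<close>.\<close>
  define W where "W = (SUP d\<in>{d. d division_of {a..b}}. \<Sum>K\<in>d. \<bar>incr f K\<bar>)"
  have bdd: "bdd_above ((\<lambda>d. \<Sum>K\<in>d. \<bar>incr f K\<bar>) ` {d. d division_of {a..b}})"
    using B by (auto simp: bdd_above_def)
  have ne: "{d. d division_of {a..b}} \<noteq> {}"
    using division_of_self[of a b] ab by (auto simp: cbox_interval)
  have W: "(\<Sum>K\<in>d. \<bar>incr f K\<bar>) \<le> W" if "d division_of {a..b}" for d
    unfolding W_def using that bdd by (intro cSUP_upper) auto
  have "W - \<alpha> * e < W" using \<alpha> e by simp
  then obtain d where d: "d division_of {a..b}" and dW: "W - \<alpha> * e < (\<Sum>K\<in>d. \<bar>incr f K\<bar>)"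
    unfolding W_def using less_cSUP_iff[OF ne bdd] by auto
  define sg where "sg K = (if 0 \<le> incr f K then 1 else - 1 :: real)" for K
  define P where "P u v \<longleftrightarrow> u < v \<and> (\<exists>K\<in>d. {u..v} \<subseteq> K \<and> \<alpha> * (v - u) \<le> - sg K * (f v - f u))" for u v
  show "\<exists>T. ?S \<subseteq> T \<and> T \<in> lmeasurable \<and> measure lebesgue T \<le> e"
  \<comment> \<open>With the finitely many division points removed, each remaining \<open>t\<close>
    is interior to its cell, and short intervals containing \<open>t\<close> stay inside that
    cell.\<close>
  proof (rule vitali_outer_measure_le[where P = P and N = "Inf ` d \<union> Sup ` d"])
    show "negligible (Inf ` d \<union> Sup ` d)"
      using division_ofD(1)[OF d] by (intro negligible_finite) auto
    show "u < v" if "P u v" for u v using that P_def by blast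
    show "\<exists>u v. P u v \<and> t \<in> {u..v} \<and> v - u < r"
      if t: "t \<in> ?S - (Inf ` d \<union> Sup ` d)" and r: "0 < r" for t r
    proof -
      have "t \<in> {a..b}" using t by auto
      then obtain K where K: "K \<in> d" "t \<in> K" using division_ofD(6)[OF d] by blast
      note KI = division_of_real[OF d K(1)]
      have tK: "Inf K < t" "t < Sup K"
      proof -
        have "t \<noteq> Inf K" "t \<noteq> Sup K" using t K(1) by auto
        moreover have "t \<in> {Inf K..Sup K}" using K(2) KI(1) by blast
        ultimately show "Inf K < t" "t < Sup K" by auto
      qed
      let ?e = "min r (min (t - Inf K) (Sup K - t))"
      have "\<exists>\<^sub>F s in at t. \<alpha> \<le> - sg K * ((f s - f t) / (s - t))"
      proof (cases "0 \<le> incr f K")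
        case True
        then have sgK: "sg K = 1" by (simp add: sg_def)
        have "\<exists>\<^sub>F s in at t. (f s - f t) / (s - t) < - \<alpha>" using t by blast
        then show ?thesis
          by (rule frequently_elim1) (unfold sgK, linarith)
      next
        case False
        then have sgK: "sg K = - 1" by (simp add: sg_def)
        have "\<exists>\<^sub>F s in at t. \<alpha> < (f s - f t) / (s - t)" using t by blast
        then show ?thesis
          by (rule frequently_elim1) (unfold sgK, linarith)
      qed
      moreover have "0 < ?e" using r tK by simp
      ultimately obtain u v m where uv: "u < v" "t \<in> {u..v}" "v - u < ?e" "\<alpha> \<le> - sg K * m"
          "f v - f u = m * (v - u)"
        by (rule steep_interval[where Q = "\<lambda>m. \<alpha> \<le> - sg K * m"])
      have "{u..v} \<subseteq> K"
        using uv(2,3) by (subst KI(1)) auto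
      moreover have "\<alpha> * (v - u) \<le> - sg K * (f v - f u)"
        using mult_right_mono[OF uv(4), of "v - u"] uv(1,5) by simp
      ultimately show ?thesis
        using uv K(1) unfolding P_def by (intro exI[of _ u] exI[of _ v]) auto
    qed
    show "(\<Sum>(u, v)\<in>D. v - u) \<le> e"
      if D: "finite D" "\<And>u v. (u, v) \<in> D \<Longrightarrow> P u v"
        "pairwise (\<lambda>i j. disjnt {fst i..snd i} {fst j..snd j}) D" for D
    proof -
      \<comment> \<open>Every selected interval is assigned to one cell \<open>k i\<close>
        containing it. Each cell is then refined by the intervals assigned to it, and together the
        refinements divide \<open>{a..b}\<close>, so that their variation is at most
        \<open>W\<close>.\<close>
      have "\<forall>i\<in>D. \<exists>K. K \<in> d \<and> {fst i..snd i} \<subseteq> K \<and>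
          \<alpha> * (snd i - fst i) \<le> - sg K * (f (snd i) - f (fst i))"
        using D(2) unfolding P_def by (metis prod.collapse)
      then obtain k where k: "\<And>i. i \<in> D \<Longrightarrow> k i \<in> d \<and> {fst i..snd i} \<subseteq> k i \<and>
          \<alpha> * (snd i - fst i) \<le> - sg (k i) * (f (snd i) - f (fst i))"
        by (auto dest!: bchoice)
      have ex: "\<exists>q. q division_of K \<and>
          \<bar>incr f K\<bar> + \<alpha> * (\<Sum>(u, v)\<in>{i \<in> D. k i = K}. v - u) \<le> (\<Sum>J\<in>q. \<bar>incr f J\<bar>)"
        if "K \<in> d" for K
      proof -
        let ?D = "{i \<in> D. k i = K}" and ?F = "(\<lambda>(u, v). {u..v}) ` {i \<in> D. k i = K}"
        have D': "finite ?D" "\<And>u v. (u, v) \<in> ?D \<Longrightarrow> u < v"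
          "pairwise (\<lambda>i j. disjnt {fst i..snd i} {fst j..snd j}) ?D"
          using D unfolding P_def by (auto intro: pairwise_subset)
        note KI = division_of_real[OF d that]
        obtain q where q: "q division_of {Inf K..Sup K}"
          "\<bar>incr f {Inf K..Sup K}\<bar> + \<alpha> * (\<Sum>J\<in>?F. measure lborel J) \<le> (\<Sum>J\<in>q. \<bar>incr f J\<bar>)"
        proof (rule division_refine_incr[OF KI(2) disjoint_intervals_division(1)[OF D']])
          show "\<Union>?F \<subseteq> {Inf K..Sup K}"
            using k by (subst KI(1)[symmetric]) fastforce
          show "\<bar>sg K\<bar> = 1" "0 \<le> sg K * incr f {Inf K..Sup K}"
            using KI by (auto simp: sg_def)
          show "\<alpha> * measure lborel J \<le> - sg K * incr f J" if "J \<in> ?F" for J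
            using that k D'(2) by fastforce
        qed
        have "(\<Sum>J\<in>?F. measure lborel J) = (\<Sum>(u, v)\<in>?D. measure lborel {u..v})"
          by (rule disjoint_intervals_division(2)[OF D'])
        also have "\<dots> = (\<Sum>(u, v)\<in>?D. v - u)"
        proof (rule sum.cong)
          fix x assume "x \<in> ?D"
          then have "fst x < snd x" using D'(2)[of "fst x" "snd x"] by simp
          then show "(case x of (u, v) \<Rightarrow> measure lborel {u..v}) = (case x of (u, v) \<Rightarrow> v - u)"
            by (simp add: case_prod_beta)
        qed simp
        finally have "(\<Sum>J\<in>?F. measure lborel J) = (\<Sum>(u, v)\<in>?D. v - u)" .
        with q KI show ?thesis by auto
      qed
      from bchoice[OF ballI, OF ex] obtain q where "\<forall>K\<in>d. q K division_of K \<and>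
          \<bar>incr f K\<bar> + \<alpha> * (\<Sum>(u, v)\<in>{i \<in> D. k i = K}. v - u) \<le> (\<Sum>J\<in>q K. \<bar>incr f J\<bar>)" ..
      then have q: "\<And>K. K \<in> d \<Longrightarrow> q K division_of K"
          "\<And>K. K \<in> d \<Longrightarrow> \<bar>incr f K\<bar> + \<alpha> * (\<Sum>(u, v)\<in>{i \<in> D. k i = K}. v - u) \<le> (\<Sum>J\<in>q K. \<bar>incr f J\<bar>)"
        by blast+
      have "k ` D \<subseteq> d" using k by blast
      then have group: "(\<Sum>(u, v)\<in>D. v - u) = (\<Sum>K\<in>d. \<Sum>(u, v)\<in>{i \<in> D. k i = K}. v - u)"
        by (rule sum.group[OF D(1) division_ofD(1)[OF d], symmetric])
      have "(\<Sum>K\<in>d. \<bar>incr f K\<bar>) + \<alpha> * (\<Sum>(u, v)\<in>D. v - u)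
          = (\<Sum>K\<in>d. \<bar>incr f K\<bar> + \<alpha> * (\<Sum>(u, v)\<in>{i \<in> D. k i = K}. v - u))"
        unfolding sum.distrib group sum_distrib_left ..
      also have "\<dots> \<le> (\<Sum>K\<in>d. \<Sum>J\<in>q K. \<bar>incr f J\<bar>)"
        using q(2) by (rule sum_mono)
      also have "\<dots> \<le> W"
        using division_refine(2)[where f = f, OF d q(1)] W[OF division_refine(1)[OF d q(1)]] by simp
      finally have "\<alpha> * (\<Sum>(u, v)\<in>D. v - u) < \<alpha> * e" using dW by linarith
      then show ?thesis using \<alpha> by simp
    qed
  qed
qed

text \<open>Around each such point there are arbitrarily short intervals over which \<open>f\<close>
  changes by at least \<open>M\<close> times the length. Disjoint ones have joint variation at most
  \<open>B\<close>, hence total length at most \<open>B / M\<close>, and \<open>M\<close> may be as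
  large as desired.\<close>

lemma negligible_infinite_slope:
  fixes f :: "real \<Rightarrow> real"
  assumes ab: "a \<le> b"
    and B: "\<And>d. d division_of {a..b} \<Longrightarrow> (\<Sum>K\<in>d. \<bar>incr f K\<bar>) \<le> B"
  shows "negligible {t \<in> {a<..<b}. \<forall>M. \<exists>\<^sub>F s in at t. M < \<bar>(f s - f t) / (s - t)\<bar>}" (is "negligible ?S")
  unfolding negligible_outer_le
proof (intro allI impI)
  fix e :: real assume e: "0 < e"
  have "0 \<le> B"
    using B[of "{{a..b}}"] division_of_self[of a b] ab by (auto simp: cbox_interval)
  \<comment> \<open>The summand 1 keeps \<open>M\<close> positive even for
    \<open>B = 0\<close>.\<close>
  define M where "M = (B + 1) / e"
  have M: "0 < M" "B \<le> M * e" using e \<open>0 \<le> B\<close> by (auto simp: M_def)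
  define P where "P u v \<longleftrightarrow> u < v \<and> {u..v} \<subseteq> {a..b} \<and> M * (v - u) \<le> \<bar>f v - f u\<bar>" for u v
  show "\<exists>T. ?S \<subseteq> T \<and> T \<in> lmeasurable \<and> measure lebesgue T \<le> e"
  proof (rule vitali_outer_measure_le[where P = P and N = "{}"])
    show "u < v" if "P u v" for u v using that P_def by blast
    show "\<exists>u v. P u v \<and> t \<in> {u..v} \<and> v - u < r"
      if t: "t \<in> ?S - {}" and r: "0 < r" for t r
    proof -
      let ?e = "min r (min (t - a) (b - t))"
      have "\<exists>\<^sub>F s in at t. M \<le> \<bar>(f s - f t) / (s - t)\<bar>"
        using t by (auto elim!: frequently_elim1 dest!: spec[of _ M])
      moreover have "0 < ?e" using r t by simp
      ultimately obtain u v m where uv: "u < v" "t \<in> {u..v}" "v - u < ?e" "M \<le> \<bar>m\<bar>"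
          "f v - f u = m * (v - u)"
        by (rule steep_interval[where Q = "\<lambda>m. M \<le> \<bar>m\<bar>"])
      moreover have "{u..v} \<subseteq> {a..b}" using uv(2,3) by auto
      moreover have "M * (v - u) \<le> \<bar>f v - f u\<bar>"
        using mult_right_mono[OF uv(4), of "v - u"] uv(1,5) by (simp add: abs_mult)
      ultimately show ?thesis
        unfolding P_def by (intro exI[of _ u] exI[of _ v]) auto
    qed
    show "(\<Sum>(u, v)\<in>D. v - u) \<le> e"
      if D: "finite D" "\<And>u v. (u, v) \<in> D \<Longrightarrow> P u v"
        "pairwise (\<lambda>i j. disjnt {fst i..snd i} {fst j..snd j}) D" for D
    proof -
      let ?F = "(\<lambda>(u, v). {u..v}) ` D"
      have D': "\<And>u v. (u, v) \<in> D \<Longrightarrow> u < v" using D(2) P_def by blast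
      have "\<Union>?F \<subseteq> {a..b}" using D(2) unfolding P_def by fastforce
      then obtain q where q: "?F \<subseteq> q" "q division_of {a..b}"
        using partial_division_extend_interval[OF disjoint_intervals_division(1)[OF D(1) D' D(3)], of a b]
        by (auto simp: cbox_interval)
      have "M * (\<Sum>(u, v)\<in>D. v - u) = (\<Sum>(u, v)\<in>D. M * (v - u))"
        by (simp add: sum_distrib_left case_prod_beta)
      also have "\<dots> \<le> (\<Sum>(u, v)\<in>D. \<bar>incr f {u..v}\<bar>)"
        using D(2) unfolding P_def by (intro sum_mono) (fastforce dest: less_imp_le)
      also have "\<dots> = (\<Sum>K\<in>?F. \<bar>incr f K\<bar>)"
        using disjoint_intervals_division(2)[OF D(1) D' D(3), of "\<lambda>K. \<bar>incr f K\<bar>"] by simp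
      also have "\<dots> \<le> (\<Sum>K\<in>q. \<bar>incr f K\<bar>)"
        using q division_ofD(1)[OF q(2)] by (intro sum_mono2) auto
      also have "\<dots> \<le> M * e" using B[OF q(2)] M(2) by simp
      finally show ?thesis using M(1) by simp
    qed
  qed simp
qed

text \<open>Subtracting a linear function whose slope is the midpoint of \<open>p\<close> and
  \<open>r\<close> turns the two thresholds into \<open>- \<alpha>\<close> and
  \<open>\<alpha>\<close>, the case of \<open>negligible_oscillating_slope\<close>. The variation
  grows by at most \<open>\<bar>m\<bar> * (b - a)\<close>.\<close>

lemma negligible_two_slopes:
  fixes f :: "real \<Rightarrow> real"
  assumes ab: "a \<le> b" and pr: "p < r"
    and B: "\<And>d. d division_of {a..b} \<Longrightarrow> (\<Sum>K\<in>d. \<bar>incr f K\<bar>) \<le> B"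
  shows "negligible {t \<in> {a<..<b}. (\<exists>\<^sub>F s in at t. (f s - f t) / (s - t) < p) \<and>
           (\<exists>\<^sub>F s in at t. r < (f s - f t) / (s - t))}" (is "negligible ?S")
proof -
  define m where "m = (p + r) / 2"
  define \<alpha> where "\<alpha> = (r - p) / 2"
  define g where "g t = f t - m * t" for t
  have slope: "\<forall>\<^sub>F s in at t. (g s - g t) / (s - t) = (f s - f t) / (s - t) - m" for t
    using eventually_at_topological by (auto simp: eventually_at_filter g_def field_simps)
  have "negligible {t \<in> {a<..<b}. (\<exists>\<^sub>F s in at t. (g s - g t) / (s - t) < - \<alpha>) \<and>
           (\<exists>\<^sub>F s in at t. \<alpha> < (g s - g t) / (s - t))}" (is "negligible ?S'")
  proof (rule negligible_oscillating_slope[OF ab])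
    show "0 < \<alpha>" using pr by (simp add: \<alpha>_def)
    fix d assume d: "d division_of {a..b}"
    have "(\<Sum>K\<in>d. \<bar>incr g K\<bar>) \<le> (\<Sum>K\<in>d. \<bar>incr f K\<bar> + \<bar>m\<bar> * (Sup K - Inf K))"
    proof (rule sum_mono)
      fix K assume "K \<in> d"
      then have "\<bar>m * (Sup K - Inf K)\<bar> = \<bar>m\<bar> * (Sup K - Inf K)"
        using division_of_real(2)[OF d] by (simp add: abs_mult)
      then show "\<bar>incr g K\<bar> \<le> \<bar>incr f K\<bar> + \<bar>m\<bar> * (Sup K - Inf K)"
        unfolding g_def by (simp add: algebra_simps)
    qed
    also have "\<dots> = (\<Sum>K\<in>d. \<bar>incr f K\<bar>) + \<bar>m\<bar> * (b - a)"
      using sum_incr_division[OF ab d, of "\<lambda>x. x"] by (simp add: sum.distrib flip: sum_distrib_left)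
    also have "\<dots> \<le> B + \<bar>m\<bar> * (b - a)"
      using B[OF d] by simp
    finally show "(\<Sum>K\<in>d. \<bar>incr g K\<bar>) \<le> B + \<bar>m\<bar> * (b - a)" .
  qed
  moreover have "?S \<subseteq> ?S'"
  proof clarsimp
    fix t assume p: "\<exists>\<^sub>F s in at t. (f s - f t) / (s - t) < p"
      and r: "\<exists>\<^sub>F s in at t. r < (f s - f t) / (s - t)"
    have "p - m = - \<alpha>" "r - m = \<alpha>" by (auto simp: m_def \<alpha>_def field_simps)
    then show "(\<exists>\<^sub>F s in at t. (g s - g t) / (s - t) < - \<alpha>) \<and> (\<exists>\<^sub>F s in at t. \<alpha> < (g s - g t) / (s - t))"
      by (intro conjI frequently_mp[OF eventually_mono[OF slope] p]
          frequently_mp[OF eventually_mono[OF slope] r]) linarith+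
  qed
  ultimately show ?thesis by (rule negligible_subset)
qed

text \<open>Lebesgue's differentiation theorem. If the lower and upper limits of the difference
  quotient at \<open>t\<close> differ, two rationals \<open>p < r\<close> fit strictly between them
  and \<open>t\<close> lies in \<open>E p r\<close>. If they agree, the quotient converges in the
  extended reals, and outside \<open>Einf\<close> the limit is finite. Only countably many null sets
  are involved.\<close>

theorem bounded_variation_imp_differentiable_ae:
  fixes f :: "real \<Rightarrow> real"
  assumes ab: "a \<le> b"
    and B: "\<And>d. d division_of {a..b} \<Longrightarrow> (\<Sum>K\<in>d. \<bar>incr f K\<bar>) \<le> B"
  shows "negligible {t \<in> {a<..<b}. \<not> f differentiable (at t)}"
proof -
  define E where "E p r = {t \<in> {a<..<b}. (\<exists>\<^sub>F s in at t. (f s - f t) / (s - t) < p) \<and>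
           (\<exists>\<^sub>F s in at t. r < (f s - f t) / (s - t))}" for p r
  define Einf where "Einf = {t \<in> {a<..<b}. \<forall>M. \<exists>\<^sub>F s in at t. M < \<bar>(f s - f t) / (s - t)\<bar>}"
  define N where "N = \<Union>((\<lambda>(p, r). E (real_of_rat p) (real_of_rat r)) ` {(p, r). p < r}) \<union> Einf"
  have "negligible (\<Union>((\<lambda>(p, r). E (real_of_rat p) (real_of_rat r)) ` {(p, r). p < r}))"
  proof (rule negligible_countable_Union)
    show "countable ((\<lambda>(p, r). E (real_of_rat p) (real_of_rat r)) ` {(p, r). p < r})"
      by blast
    show "negligible S" if "S \<in> (\<lambda>(p, r). E (real_of_rat p) (real_of_rat r)) ` {(p, r). p < r}" for S
      using that negligible_two_slopes[OF ab _ B] by (auto simp: E_def of_rat_less)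
  qed
  moreover have "negligible Einf"
    unfolding Einf_def using negligible_infinite_slope[OF ab B] .
  ultimately have N: "negligible N"
    unfolding N_def by (rule negligible_Un)
  have "f differentiable (at t)" if t: "t \<in> {a<..<b}" "t \<notin> N" for t
  proof -
    let ?q = "\<lambda>s. (f s - f t) / (s - t)"
    let ?X = "\<lambda>s. ereal (?q s)"
    have ntriv: "\<not> trivial_limit (at t)" by simp
    have "Limsup (at t) ?X \<le> Liminf (at t) ?X"
    proof (rule ccontr)
      assume "\<not> Limsup (at t) ?X \<le> Liminf (at t) ?X"
      then have less: "Liminf (at t) ?X < Limsup (at t) ?X" by simp
      obtain p where p: "Liminf (at t) ?X < ereal (of_rat p)" "ereal (of_rat p) < Limsup (at t) ?X"
        using ereal_dense3[OF less] by blast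
      obtain r where r: "ereal (of_rat p) < ereal (of_rat r)" "ereal (of_rat r) < Limsup (at t) ?X"
        using ereal_dense3[OF p(2)] by blast
      obtain y where "y < ereal (of_rat p)" "\<exists>\<^sub>F s in at t. ?X s \<le> y"
        using p(1) le_Liminf_iff[of "ereal (of_rat p)" "at t" ?X] by (auto simp: not_le[symmetric] not_eventually)
      then have *: "\<exists>\<^sub>F s in at t. ?q s < of_rat p"
        by (auto elim!: frequently_elim1 dest: order.strict_trans1)
      obtain y where "y > ereal (of_rat r)" "\<exists>\<^sub>F s in at t. y \<le> ?X s"
        using r(2) Limsup_le_iff[of "at t" ?X "ereal (of_rat r)"] by (auto simp: not_le[symmetric] not_eventually)
      then have "\<exists>\<^sub>F s in at t. of_rat r < ?q s"
        by (auto elim!: frequently_elim1 dest: order.strict_trans2)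
      with * t r(1) show False
        unfolding N_def E_def by (auto simp: of_rat_less)
    qed
    then have eq: "Limsup (at t) ?X = Liminf (at t) ?X"
      using Liminf_le_Limsup[OF ntriv, of ?X] by (rule antisym)
    have lim: "(?X \<longlongrightarrow> Liminf (at t) ?X) (at t)"
      by (rule Liminf_eq_Limsup[OF ntriv refl eq])
    obtain M where M: "\<forall>\<^sub>F s in at t. \<bar>?q s\<bar> \<le> M"
      using t unfolding N_def Einf_def by (auto simp: not_frequently not_less)
    have "ereal (- M) \<le> Liminf (at t) ?X"
      by (rule Liminf_bounded, rule eventually_mono[OF M]) (metis abs_le_iff ereal_less_eq(3) minus_le_iff)
    moreover have "Limsup (at t) ?X \<le> ereal M"
      by (rule Limsup_bounded, rule eventually_mono[OF M]) (metis abs_le_iff ereal_less_eq(3) minus_le_iff)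
    ultimately obtain l where "Liminf (at t) ?X = ereal l"
      unfolding eq by (cases "Liminf (at t) ?X") auto
    with lim have "(?q \<longlongrightarrow> l) (at t)" by simp
    then have "(f has_field_derivative l) (at t)"
      by (simp add: has_field_derivative_iff)
    then show ?thesis
      by (auto simp: differentiable_def has_field_derivative_def)
  qed
  then show ?thesis
    by (intro negligible_subset[OF N]) blast
qed

subsection \<open>Absolutely continuous curves\<close>

lemma absolutely_continuous_on_subset:
  assumes "absolutely_continuous_on S f" "T \<subseteq> S"
  shows "absolutely_continuous_on T f"
  unfolding absolutely_continuous_on_def
proof (intro allI impI)
  fix \<epsilon> :: real assume "\<epsilon> > 0"
  then obtain \<delta> where "\<delta> > 0" and \<delta>: "\<And>D. finite D \<Longrightarrow> \<forall>(a, b)\<in>D. a \<le> b \<and> {a..b} \<subseteq> S \<Longrightarrow>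
      disjoint_family_on (\<lambda>(a, b). {a<..<b}) D \<Longrightarrow> (\<Sum>(a, b)\<in>D. b - a) < \<delta> \<Longrightarrow>
      (\<Sum>(a, b)\<in>D. dist (f a) (f b)) < \<epsilon>"
    using assms(1) unfolding absolutely_continuous_on_def by meson
  show "\<exists>\<delta>>0. \<forall>D. finite D \<and> (\<forall>(a, b)\<in>D. a \<le> b \<and> {a..b} \<subseteq> T) \<and>
      disjoint_family_on (\<lambda>(a, b). {a<..<b}) D \<and> (\<Sum>(a, b)\<in>D. b - a) < \<delta> \<longrightarrow>
      (\<Sum>(a, b)\<in>D. dist (f a) (f b)) < \<epsilon>"
    using \<open>\<delta> > 0\<close> assms(2) by (intro exI[of _ \<delta>] conjI allI impI \<delta>) fastforce+
qed

text \<open>The form of the condition that bounds variation: the cells of a division are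
  non-overlapping and their lengths add up to that of the whole interval. The same \<delta> serves
  all short intervals in \<open>S\<close>.\<close>

lemma absolutely_continuous_on_division:
  fixes f :: "real \<Rightarrow> 'a::metric_space"
  assumes "absolutely_continuous_on S f" "\<epsilon> > 0"
  obtains \<delta> where "\<delta> > 0"
    "\<And>a b d. a \<le> b \<Longrightarrow> {a..b} \<subseteq> S \<Longrightarrow> b - a < \<delta> \<Longrightarrow> d division_of {a..b} \<Longrightarrow>
      (\<Sum>K\<in>d. dist (f (Inf K)) (f (Sup K))) < \<epsilon>"
proof -
  obtain \<delta> where "\<delta> > 0" and \<delta>: "\<And>D. finite D \<Longrightarrow> \<forall>(a, b)\<in>D. a \<le> b \<and> {a..b} \<subseteq> S \<Longrightarrow>
      disjoint_family_on (\<lambda>(a, b). {a<..<b}) D \<Longrightarrow> (\<Sum>(a, b)\<in>D. b - a) < \<delta> \<Longrightarrow>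
      (\<Sum>(a, b)\<in>D. dist (f a) (f b)) < \<epsilon>"
    using assms unfolding absolutely_continuous_on_def by meson
  have "(\<Sum>K\<in>d. dist (f (Inf K)) (f (Sup K))) < \<epsilon>"
    if ab: "a \<le> b" "{a..b} \<subseteq> S" "b - a < \<delta>" and d: "d division_of {a..b}" for a b d
  proof -
    let ?e = "\<lambda>K :: real set. (Inf K, Sup K)"
    note dI = division_of_real[OF d]
    have inj: "inj_on ?e d"
    proof (rule inj_onI)
      fix K1 K2 assume "K1 \<in> d" "K2 \<in> d" "?e K1 = ?e K2"
      with dI(1)[of K1] dI(1)[of K2] show "K1 = K2" by simp
    qed
    have "(\<Sum>(u, v)\<in>?e ` d. dist (f u) (f v)) < \<epsilon>"
    proof (rule \<delta>)
      show "finite (?e ` d)" using division_ofD(1)[OF d] by simp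
      show "\<forall>(u, v)\<in>?e ` d. u \<le> v \<and> {u..v} \<subseteq> S"
      proof clarsimp
        fix K assume K: "K \<in> d"
        then have "{Inf K..Sup K} \<subseteq> S"
          using dI(1)[OF K] division_ofD(2)[OF d K] ab(2) by blast
        then show "Inf K \<le> Sup K \<and> {Inf K..Sup K} \<subseteq> S" using dI(2)[OF K] by simp
      qed
      have "{Inf K1<..<Sup K1} \<inter> {Inf K2<..<Sup K2} = {}" if "K1 \<in> d" "K2 \<in> d" "K1 \<noteq> K2" for K1 K2
        using division_ofD(5)[OF d that] dI(1)[OF that(1)] dI(1)[OF that(2)]
        by (metis interior_atLeastAtMost_real)
      then show "disjoint_family_on (\<lambda>(a, b). {a<..<b}) (?e ` d)"
        unfolding disjoint_family_on_def by fastforce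
      show "(\<Sum>(a, b)\<in>?e ` d. b - a) < \<delta>"
        using sum_incr_division[OF ab(1) d, of "\<lambda>x. x"] ab(3)
        by (subst sum.reindex[OF inj]) (simp add: o_def)
    qed
    then show ?thesis
      by (subst (asm) sum.reindex[OF inj]) (simp add: o_def)
  qed
  with \<open>\<delta> > 0\<close> show thesis by (rule that)
qed

lemma absolutely_continuous_on_imp_continuous_on:
  fixes f :: "real \<Rightarrow> 'a::metric_space"
  assumes "absolutely_continuous_on {a..b} f"
  shows "continuous_on {a..b} f"
  unfolding continuous_on_iff
proof (intro ballI allI impI)
  fix t \<epsilon> :: real assume t: "t \<in> {a..b}" and "\<epsilon> > 0"
  obtain \<delta> where \<delta>: "\<delta> > 0"
    "\<And>u v d. u \<le> v \<Longrightarrow> {u..v} \<subseteq> {a..b} \<Longrightarrow> v - u < \<delta> \<Longrightarrow> d division_of {u..v} \<Longrightarrow>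
      (\<Sum>K\<in>d. dist (f (Inf K)) (f (Sup K))) < \<epsilon>"
    using absolutely_continuous_on_division[OF assms \<open>\<epsilon> > 0\<close>] by blast
  have *: "dist (f u) (f v) < \<epsilon>" if "u \<le> v" "{u..v} \<subseteq> {a..b}" "v - u < \<delta>" for u v
    using \<delta>(2)[OF that, of "{{u..v}}"] division_of_self[of u v] that(1) by (auto simp: cbox_interval)
  show "\<exists>d>0. \<forall>s\<in>{a..b}. dist s t < d \<longrightarrow> dist (f s) (f t) < \<epsilon>"
  proof (intro exI[of _ \<delta>] conjI ballI impI)
    fix s assume s: "s \<in> {a..b}" "dist s t < \<delta>"
    show "dist (f s) (f t) < \<epsilon>"
      using *[of s t] *[of t s] s t by (cases "s \<le> t") (auto simp: dist_real_def dist_commute)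
  qed (rule \<delta>(1))
qed

text \<open>Take the \<delta> belonging to \<epsilon> = 1. On an interval shorter than \<delta>
  every coordinate has variation at most 1, so the theorem on bounded variation applies to it. The
  exceptional set is thus null near each of its points, and therefore null.\<close>

theorem absolutely_continuous_imp_differentiable_ae:
  fixes f :: "real \<Rightarrow> 'a::euclidean_space"
  assumes "absolutely_continuous_on {a..b} f"
  shows "negligible {t \<in> {a<..<b}. \<not> f differentiable (at t)}" (is "negligible ?S")
  unfolding locally_negligible_alt[of ?S]
proof
  obtain \<delta> where \<delta>: "\<delta> > 0"
    "\<And>u v d. u \<le> v \<Longrightarrow> {u..v} \<subseteq> {a..b} \<Longrightarrow> v - u < \<delta> \<Longrightarrow> d division_of {u..v} \<Longrightarrow>
      (\<Sum>K\<in>d. dist (f (Inf K)) (f (Sup K))) < 1"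
    using absolutely_continuous_on_division[OF assms, of 1] by auto
  fix t assume t: "t \<in> ?S"
  define u v where "u = max a (t - \<delta> / 3)" and "v = min b (t + \<delta> / 3)"
  have uv: "u < t" "t < v" "{u..v} \<subseteq> {a..b}" "v - u < \<delta>" "u \<le> v"
    using t \<delta>(1) by (auto simp: u_def v_def)
  have "negligible {s \<in> {u<..<v}. \<not> (\<lambda>t. f t \<bullet> i) differentiable (at s)}" if i: "i \<in> Basis" for i
  proof (rule bounded_variation_imp_differentiable_ae[OF uv(5)])
    fix d assume d: "d division_of {u..v}"
    have "(\<Sum>K\<in>d. \<bar>f (Sup K) \<bullet> i - f (Inf K) \<bullet> i\<bar>) \<le> (\<Sum>K\<in>d. dist (f (Inf K)) (f (Sup K)))"
      using i by (intro sum_mono) (metis Basis_le_norm dist_commute dist_norm inner_diff_left)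
    also have "\<dots> \<le> 1" using \<delta>(2)[OF uv(5,3,4) d] by simp
    finally show "(\<Sum>K\<in>d. \<bar>f (Sup K) \<bullet> i - f (Inf K) \<bullet> i\<bar>) \<le> 1" .
  qed
  then have "negligible (\<Union>i\<in>Basis. {s \<in> {u<..<v}. \<not> (\<lambda>t. f t \<bullet> i) differentiable (at s)})"
    by (intro negligible_Union) auto
  then have "negligible (?S \<inter> {u<..<v})"
    by (rule negligible_subset) (auto simp: differentiable_componentwise_within[of f])
  moreover have "openin (top_of_set ?S) (?S \<inter> {u<..<v})"
    by (intro openin_open_Int) auto
  ultimately show "\<exists>U. openin (top_of_set ?S) U \<and> t \<in> U \<and> negligible U"
    using t uv by (intro exI[of _ "?S \<inter> {u<..<v}"]) auto
qed

section \<open>Monotonicity along an absolutely continuous curve from the sign of the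
  derivative\<close>

lemma sum_length_le_measure:
  fixes D :: "(real \<times> real) set"
  assumes "finite D" "\<forall>(s, t)\<in>D. s \<le> t \<and> {s..t} \<subseteq> U"
    and "disjoint_family_on (\<lambda>(a, b). {a<..<b}) D" "U \<in> lmeasurable"
  shows "(\<Sum>(s, t)\<in>D. t - s) \<le> measure lebesgue U"
proof -
  have "(\<Sum>(s, t)\<in>D. t - s) = (\<Sum>i\<in>D. measure lebesgue {fst i<..<snd i})"
    using assms(2) by (intro sum.cong) auto
  also have "\<dots> = measure lebesgue (\<Union>i\<in>D. {fst i<..<snd i})"
    using assms(1,3) by (intro measure_UNION'[symmetric])
      (auto simp: pairwise_def disjnt_def disjoint_family_on_def case_prod_beta)
  also have "\<dots> \<le> measure lebesgue U"
  proof (rule measure_mono_fmeasurable)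
    show "(\<Union>i\<in>D. {fst i<..<snd i}) \<subseteq> U"
      using assms(2) by fastforce
  qed (use assms in auto)
  finally show ?thesis .
qed

text \<open>The first-order estimates to the left and to the right of \<open>x\<close> add up. An
  interval merely containing \<open>x\<close> is allowed, because the bisection below does not
  produce intervals that end at \<open>x\<close>.\<close>

lemma has_real_derivative_straddle:
  fixes f :: "real \<Rightarrow> real"
  assumes "(f has_real_derivative c) (at x)" "c \<le> 0" "\<epsilon> > 0"
  shows "\<exists>d>0. \<forall>u v. u \<le> x \<and> x \<le> v \<and> v - u < d \<longrightarrow> f v - f u \<le> \<epsilon> * (v - u)"
proof -
  have "(f has_derivative (\<lambda>h. c * h)) (at x)"
    using assms(1) by (simp add: has_field_derivative_def)
  then obtain d where d: "d > 0" "\<And>s. \<bar>s - x\<bar> < d \<Longrightarrow> \<bar>f s - f x - c * (s - x)\<bar> \<le> \<epsilon> * \<bar>s - x\<bar>"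
    using \<open>\<epsilon> > 0\<close> unfolding has_derivative_at_alt real_norm_def by meson
  show ?thesis
  proof (intro exI[of _ d] conjI allI impI)
    fix u v assume uv: "u \<le> x \<and> x \<le> v \<and> v - u < d"
    have "\<bar>f v - f x - c * (v - x)\<bar> \<le> \<epsilon> * (v - x)" "\<bar>f u - f x - c * (u - x)\<bar> \<le> \<epsilon> * (x - u)"
      using d(2)[of v] d(2)[of u] uv by auto
    then have "f v - f u \<le> \<epsilon> * (v - u) + c * (v - u)"
      by (simp add: algebra_simps abs_le_iff)
    moreover have "c * (v - u) \<le> 0"
      using assms(2) uv by (intro mult_nonpos_nonneg) auto
    ultimately show "f v - f u \<le> \<epsilon> * (v - u)" by linarith
  qed (rule d(1))
qed

text \<open>Near a point of differentiability \<open>L \<circ> y\<close> rises by at most \<epsilon>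
  times the length. The remaining points form a null set, enclosed in an open set \<open>U\<close>
  of measure below \<delta>; there absolute continuity keeps the variation of \<open>y\<close>, and
  with it the rise of \<open>L \<circ> y\<close>, small. Patching the two estimates together bounds
  the total rise by \<open>\<epsilon> * (b - a + B)\<close>.\<close>

theorem absolutely_continuous_decreasing_along:
  fixes y :: "real \<Rightarrow> 'a::euclidean_space" and L :: "'a \<Rightarrow> real" and G :: "'a \<Rightarrow> 'a"
  assumes ab: "a \<le> b" and AC: "absolutely_continuous_on {a..b} y"
    and L: "\<And>x. (L has_derivative (\<lambda>h. G x \<bullet> h)) (at x)" and G: "continuous_on UNIV G"
    and decr: "\<And>t y'. a < t \<Longrightarrow> t < b \<Longrightarrow> (y has_vector_derivative y') (at t) \<Longrightarrow> G (y t) \<bullet> y' \<le> 0"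
  shows "L (y b) \<le> L (y a)"
proof -
  have "compact (y ` {a..b})"
    using absolutely_continuous_on_imp_continuous_on[OF AC] by (intro compact_continuous_image) auto
  \<comment> \<open>The curve is enclosed in a ball, a convex set, so that the mean value inequality
    makes \<open>L\<close> Lipschitz between any two of its points.\<close>
  then obtain R where R: "y ` {a..b} \<subseteq> cball 0 R"
    by (force dest: compact_imp_bounded simp: bounded_iff)
  have "bounded (G ` cball 0 R)"
    using G by (intro compact_imp_bounded compact_continuous_image) (auto intro: continuous_on_subset)
  then obtain B where B: "B > 0" "\<And>x. x \<in> cball 0 R \<Longrightarrow> norm (G x) \<le> B"
    by (auto simp: bounded_pos)
  have Lip: "L (y v) - L (y u) \<le> B * dist (y u) (y v)" if "u \<in> {a..b}" "v \<in> {a..b}" for u v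
  proof -
    have "norm (L (y v) - L (y u)) \<le> B * norm (y v - y u)"
    proof (rule differentiable_bound[where S = "cball 0 R"])
      show "(L has_derivative (\<lambda>h. G x \<bullet> h)) (at x within cball 0 R)" for x
        using L by (rule has_derivative_at_withinI)
      show "onorm (\<lambda>h. G x \<bullet> h) \<le> B" if "x \<in> cball 0 R" for x
        using B(2)[OF that] onorm_inner_right[OF bounded_linear_ident, of "G x"]
        by (smt (verit) onorm_le norm_cauchy_schwarz Cauchy_Schwarz_ineq2 mult_right_mono norm_ge_zero real_norm_def)
    qed (use R that in \<open>auto simp: image_subset_iff\<close>)
    then show ?thesis by (simp add: dist_norm norm_minus_commute)
  qed
  \<comment> \<open>The endpoints are counted as exceptional since \<open>decr\<close> speaks of
    interior times only.\<close>
  define N where "N = {t \<in> {a<..<b}. \<not> y differentiable (at t)} \<union> {a, b}"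
  have N: "negligible N"
    unfolding N_def using absolutely_continuous_imp_differentiable_ae[OF AC] by (intro negligible_Un) auto
  have approx: "L (y b) - L (y a) \<le> \<epsilon> * (b - a + B)" if \<epsilon>: "\<epsilon> > 0" for \<epsilon>
  proof -
    obtain \<delta> where "\<delta> > 0" and \<delta>: "\<And>D. finite D \<Longrightarrow> \<forall>(s, t)\<in>D. s \<le> t \<and> {s..t} \<subseteq> {a..b} \<Longrightarrow>
        disjoint_family_on (\<lambda>(a, b). {a<..<b}) D \<Longrightarrow> (\<Sum>(a, b)\<in>D. b - a) < \<delta> \<Longrightarrow>
        (\<Sum>(a, b)\<in>D. dist (y a) (y b)) < \<epsilon>"
      using AC \<epsilon> unfolding absolutely_continuous_on_def by meson
    obtain U where U: "open U" "N \<subseteq> U" "U - N \<in> lmeasurable" "emeasure lebesgue (U - N) < ennreal \<delta>"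
      using sets_lebesgue_outer_open[OF negligible_imp_sets[OF N] \<open>\<delta> > 0\<close>] by blast
    have U': "U \<in> lmeasurable" "measure lebesgue U < \<delta>"
    proof -
      have UN: "U = (U - N) \<union> N" using U(2) by blast
      show "U \<in> lmeasurable"
        using U(3) negligible_imp_measurable[OF N] by (subst UN) (rule fmeasurable.Un)
      have "measure lebesgue ((U - N) \<union> N) = measure lebesgue (U - N)"
        using N U(3) by (intro measure_Un_null_set) (auto simp: negligible_iff_null_sets)
      with UN have "measure lebesgue U = measure lebesgue (U - N)" by simp
      then show "measure lebesgue U < \<delta>"
        using U(3,4) \<open>\<delta> > 0\<close> by (simp add: emeasure_eq_measure2 ennreal_less_iff)
    qed
    \<comment> \<open>The rise over \<open>{u..v}\<close> is charged to its length at rate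
      \<epsilon>, plus a finite non-overlapping family inside \<open>U\<close> charged at the
      Lipschitz constant. This passes from adjacent intervals to their union and holds on all short
      intervals about each point, as Bolzano's bisection principle demands. The guard handles short
      intervals that leave \<open>{a..b}\<close>.\<close>
    define P where "P u v \<longleftrightarrow> (a \<le> u \<and> v \<le> b \<longrightarrow> (\<exists>D. finite D \<and>
        (\<forall>(s, t)\<in>D. s \<le> t \<and> {s..t} \<subseteq> U \<and> {s..t} \<subseteq> {u..v}) \<and>
        disjoint_family_on (\<lambda>(a, b). {a<..<b}) D \<and>
        L (y v) - L (y u) \<le> \<epsilon> * (v - u) + B * (\<Sum>(s, t)\<in>D. dist (y s) (y t))))" for u v
    have "P a b"
      using ab
    proof (induct rule: Bolzano)
      case (trans u w v)
      show ?case unfolding P_def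
      proof
        assume uv: "a \<le> u \<and> v \<le> b"
        from trans uv obtain D1 where D1: "finite D1"
          "\<forall>(s, t)\<in>D1. s \<le> t \<and> {s..t} \<subseteq> U \<and> {s..t} \<subseteq> {u..w}"
          "disjoint_family_on (\<lambda>(a, b). {a<..<b}) D1"
          "L (y w) - L (y u) \<le> \<epsilon> * (w - u) + B * (\<Sum>(s, t)\<in>D1. dist (y s) (y t))"
          unfolding P_def by (meson order_trans)
        from trans uv obtain D2 where D2: "finite D2"
          "\<forall>(s, t)\<in>D2. s \<le> t \<and> {s..t} \<subseteq> U \<and> {s..t} \<subseteq> {w..v}"
          "disjoint_family_on (\<lambda>(a, b). {a<..<b}) D2"
          "L (y v) - L (y w) \<le> \<epsilon> * (v - w) + B * (\<Sum>(s, t)\<in>D2. dist (y s) (y t))"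
          unfolding P_def by (meson order_trans)
        have le1: "s \<le> t \<and> {s..t} \<subseteq> U \<and> u \<le> s \<and> t \<le> w" if "(s, t) \<in> D1" for s t
          using bspec[OF D1(2) that] by auto
        have le2: "s \<le> t \<and> {s..t} \<subseteq> U \<and> w \<le> s \<and> t \<le> v" if "(s, t) \<in> D2" for s t
          using bspec[OF D2(2) that] by auto
        \<comment> \<open>The two families lie on either side of \<open>w\<close>, so a common
          member can only be the degenerate pair \<open>(w, w)\<close>.\<close>
        have "(\<Sum>(s, t)\<in>D1 \<inter> D2. dist (y s) (y t)) = 0"
        proof (intro sum.neutral ballI)
          fix i assume "i \<in> D1 \<inter> D2"
          then have "fst i = snd i"
            using le1[of "fst i" "snd i"] le2[of "fst i" "snd i"] by auto
          then show "(case i of (s, t) \<Rightarrow> dist (y s) (y t)) = 0" by (simp add: case_prod_beta)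
        qed
        then have sum: "(\<Sum>(s, t)\<in>D1 \<union> D2. dist (y s) (y t))
            = (\<Sum>(s, t)\<in>D1. dist (y s) (y t)) + (\<Sum>(s, t)\<in>D2. dist (y s) (y t))"
          using sum.union_inter[OF D1(1) D2(1), of "\<lambda>(s, t). dist (y s) (y t)"] by simp
        have sep: "{s<..<t} \<inter> {s'<..<t'} = {}" if "(s, t) \<in> D1" "(s', t') \<in> D2" for s t s' t'
          using le1[OF that(1)] le2[OF that(2)] by auto
        have "disjoint_family_on (\<lambda>(a, b). {a<..<b}) (D1 \<union> D2)"
          unfolding disjoint_family_on_def
        proof (intro ballI impI)
          fix i j assume "i \<in> D1 \<union> D2" "j \<in> D1 \<union> D2" "i \<noteq> j"
          then show "(case i of (a, b) \<Rightarrow> {a<..<b}) \<inter> (case j of (a, b) \<Rightarrow> {a<..<b}) = {}"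
            using disjoint_family_onD[OF D1(3), of i j] disjoint_family_onD[OF D2(3), of i j]
              sep[of "fst i" "snd i" "fst j" "snd j"] sep[of "fst j" "snd j" "fst i" "snd i"]
            by (auto simp: case_prod_beta)
        qed
        moreover have "\<forall>(s, t)\<in>D1 \<union> D2. s \<le> t \<and> {s..t} \<subseteq> U \<and> {s..t} \<subseteq> {u..v}"
        proof clarify
          fix s t assume "(s, t) \<in> D1 \<union> D2"
          then have "s \<le> t \<and> {s..t} \<subseteq> U \<and> u \<le> s \<and> t \<le> v"
            using le1[of s t] le2[of s t] trans(3,4) by auto
          then show "s \<le> t \<and> {s..t} \<subseteq> U \<and> {s..t} \<subseteq> {u..v}" by auto
        qed
        moreover have "L (y v) - L (y u) \<le> \<epsilon> * (v - u) + B * (\<Sum>(s, t)\<in>D1 \<union> D2. dist (y s) (y t))"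
          using D1(4) D2(4) unfolding sum by (simp add: algebra_simps)
        ultimately show "\<exists>D. finite D \<and>
            (\<forall>(s, t)\<in>D. s \<le> t \<and> {s..t} \<subseteq> U \<and> {s..t} \<subseteq> {u..v}) \<and>
            disjoint_family_on (\<lambda>(a, b). {a<..<b}) D \<and>
            L (y v) - L (y u) \<le> \<epsilon> * (v - u) + B * (\<Sum>(s, t)\<in>D. dist (y s) (y t))"
          using D1(1) D2(1) by (intro exI[of _ "D1 \<union> D2"]) auto
      qed
    next
      case (local x)
      show ?case
      proof (cases "x \<in> N")
        case True
        then obtain d where d: "d > 0" "ball x d \<subseteq> U"
          using U(1,2) open_contains_ball by blast
        have "P u v" if "u \<le> x \<and> x \<le> v \<and> v - u < d" for u v
        proof -
          have "{u..v} \<subseteq> U"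
            using that d(2) by (auto simp: dist_real_def subset_eq)
          moreover have "0 \<le> \<epsilon> * (v - u)" using \<epsilon> that by simp
          ultimately show ?thesis
            using that Lip[of u v] unfolding P_def
            by (intro impI exI[of _ "{(u, v)}"]) (auto simp: disjoint_family_on_def)
        qed
        with d(1) show ?thesis by blast
      next
        case False
        then have x: "a < x" "x < b" and "y differentiable (at x)"
          using local unfolding N_def by auto
        then obtain y' where y': "(y has_vector_derivative y') (at x)"
          using vector_derivative_works by blast
        have "((\<lambda>t. L (y t)) has_real_derivative G (y x) \<bullet> y') (at x)"
          unfolding has_field_derivative_def
          using has_derivative_compose[OF y'[unfolded has_vector_derivative_def] L]
          by (rule has_derivative_eq_rhs) (auto simp: algebra_simps)
        from has_real_derivative_straddle[OF this decr[OF x y'] \<epsilon>]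
        obtain d where d: "d > 0" "\<And>u v. u \<le> x \<and> x \<le> v \<and> v - u < d \<Longrightarrow> L (y v) - L (y u) \<le> \<epsilon> * (v - u)"
          by blast
        have "P u v" if "u \<le> x \<and> x \<le> v \<and> v - u < d" for u v
          using d(2)[OF that] unfolding P_def
          by (intro impI exI[of _ "{}"]) (auto simp: disjoint_family_on_def)
        with d(1) show ?thesis by blast
      qed
    qed
    then obtain D where D: "finite D"
      "\<forall>(s, t)\<in>D. s \<le> t \<and> {s..t} \<subseteq> U \<and> {s..t} \<subseteq> {a..b}"
      "disjoint_family_on (\<lambda>(a, b). {a<..<b}) D"
      "L (y b) - L (y a) \<le> \<epsilon> * (b - a) + B * (\<Sum>(s, t)\<in>D. dist (y s) (y t))"
      unfolding P_def by blast
    have "(\<Sum>(s, t)\<in>D. t - s) \<le> measure lebesgue U"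
      using D by (intro sum_length_le_measure U'(1)) auto
    then have "(\<Sum>(s, t)\<in>D. dist (y s) (y t)) < \<epsilon>"
      using D U'(2) by (intro \<delta>) auto
    then have "B * (\<Sum>(s, t)\<in>D. dist (y s) (y t)) \<le> B * \<epsilon>"
      using B(1) by simp
    with D(4) show ?thesis by (simp add: algebra_simps)
  qed
  show ?thesis
  proof (rule field_le_epsilon)
    fix e :: real assume "e > 0"
    moreover have "b - a + B > 0" using ab B(1) by simp
    ultimately show "L (y b) \<le> L (y a) + e"
      using approx[of "e / (b - a + B)"] by simp
  qed
qed

subsection \<open>Gradient and convexity\<close>

lemma has_derivative_gradient:
  fixes V :: "real ^ 'n::finite \<Rightarrow> real"
  assumes "V differentiable (at x)"
  shows "(V has_derivative (\<lambda>h. gradient V x \<bullet> h)) (at x)"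
proof -
  obtain V' where V': "(V has_derivative V') (at x)"
    using assms unfolding differentiable_def by blast
  have lin: "linear V'" using V' has_derivative_linear by blast
  have pd: "partial_derivative i V x = V' (axis i 1)" for i
    unfolding partial_derivative_def
  proof (rule DERIV_imp_deriv)
    have "((\<lambda>s. x + s *\<^sub>R axis i 1) has_derivative (\<lambda>s. s *\<^sub>R axis i 1)) (at (0::real))"
      by (auto intro!: derivative_eq_intros)
    from has_derivative_compose[OF this, of V V']
    have "((\<lambda>s. V (x + s *\<^sub>R axis i 1)) has_derivative (\<lambda>s. V' (s *\<^sub>R axis i 1))) (at 0)"
      using V' by simp
    then show "((\<lambda>s. V (x + s *\<^sub>R axis i 1)) has_field_derivative V' (axis i 1)) (at 0)"
      unfolding has_field_derivative_def
      by (rule has_derivative_eq_rhs) (simp add: linear_cmul[OF lin] fun_eq_iff)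
  qed
  \<comment> \<open>A linear map is determined by its values on the axis vectors, and these are the
    partial derivatives.\<close>
  have "V' = (\<lambda>h. gradient V x \<bullet> h)"
  proof (rule linear_eq_stdbasis[OF lin])
    show "linear (\<lambda>h. gradient V x \<bullet> h)"
      by (simp add: bounded_linear.linear bounded_linear_inner_right)
    show "V' b = gradient V x \<bullet> b" if "b \<in> Basis" for b
      using that by (auto simp: Basis_vec_def inner_axis gradient_def pd)
  qed
  with V' show ?thesis by simp
qed

text \<open>Component \<open>i\<close> of the gradient is \<open>partial_derivative i V\<close>,
  whose own gradient is row \<open>i\<close> of the Hessian; uniqueness of the derivative identifies
  the rows.\<close>

lemma has_derivative_gradient_hessian:
  fixes V :: "real ^ 'n::finite \<Rightarrow> real"
  assumes "gradient V differentiable (at x)"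
  shows "(gradient V has_derivative (\<lambda>h. hessian V x *v h)) (at x)"
proof -
  obtain G' where G': "(gradient V has_derivative G') (at x)"
    using assms unfolding differentiable_def by blast
  have "G' h $ i = (hessian V x *v h) $ i" for h i
  proof -
    have eq: "partial_derivative i V = (\<lambda>x. gradient V x $ i)"
      by (simp add: gradient_def)
    have d: "(partial_derivative i V has_derivative (\<lambda>h. G' h $ i)) (at x)"
      unfolding eq using bounded_linear.has_derivative[OF bounded_linear_vec_nth G'] .
    then have "(partial_derivative i V has_derivative (\<lambda>h. gradient (partial_derivative i V) x \<bullet> h)) (at x)"
      by (intro has_derivative_gradient) (auto simp: differentiable_def)
    from has_derivative_unique[OF d this]
    have "G' h $ i = gradient (partial_derivative i V) x \<bullet> h" by metis
    then show ?thesis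
      by (simp add: inner_vec_def matrix_vector_mult_def gradient_def hessian_def)
  qed
  then have "G' = (\<lambda>h. hessian V x *v h)"
    by (simp add: fun_eq_iff vec_eq_iff)
  with G' show ?thesis by simp
qed

section \<open>Strict convexity, strong convexity and bounded sublevel sets\<close>

lemma above_tangent_if_hessian_positive_definite:
  fixes V :: "real ^ 'n::finite \<Rightarrow> real"
  assumes V: "twice_differentiable V" and pd: "\<And>x. positive_definite (hessian V x)" and "x \<noteq> z"
  shows "V z + gradient V z \<bullet> (x - z) < V x"
proof -
  define d where "d = x - z"
  have d0: "d \<noteq> 0" using \<open>x \<noteq> z\<close> by (simp add: d_def)
  \<comment> \<open>On the line through \<open>z\<close> and \<open>x\<close> the second derivative
    is the Hessian form at \<open>d\<close>, which is positive. Hence \<open>\<phi>'\<close>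
    increases strictly, and the mean value theorem gives
    \<open>\<phi> 1 - \<phi> 0 = \<phi>' \<xi> > \<phi>' 0\<close>.\<close>
  define \<phi> where "\<phi> s = V (z + s *\<^sub>R d)" for s
  define \<phi>' where "\<phi>' s = gradient V (z + s *\<^sub>R d) \<bullet> d" for s
  have line: "((\<lambda>s. z + s *\<^sub>R d) has_derivative (\<lambda>h. h *\<^sub>R d)) (at s)" for s :: real
    by (auto intro!: derivative_eq_intros)
  have D1: "(\<phi> has_real_derivative \<phi>' s) (at s)" for s
  proof -
    have "(V has_derivative (\<lambda>h. gradient V (z + s *\<^sub>R d) \<bullet> h)) (at (z + s *\<^sub>R d))"
      using V by (intro has_derivative_gradient) (auto simp: twice_differentiable_def)
    from has_derivative_compose[OF line this] show ?thesis
      unfolding has_field_derivative_def \<phi>_def \<phi>'_def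
      by (rule has_derivative_eq_rhs) (simp add: fun_eq_iff)
  qed
  have D2: "(\<phi>' has_real_derivative d \<bullet> (hessian V (z + s *\<^sub>R d) *v d)) (at s)" for s
  proof -
    have "(gradient V has_derivative (\<lambda>h. hessian V (z + s *\<^sub>R d) *v h)) (at (z + s *\<^sub>R d))"
      using V by (intro has_derivative_gradient_hessian) (auto simp: twice_differentiable_def)
    from has_derivative_inner_left[OF has_derivative_compose[OF line this], of d] show ?thesis
      unfolding has_field_derivative_def \<phi>'_def
      by (rule has_derivative_eq_rhs)
        (simp add: fun_eq_iff matrix_vector_mult_scaleR inner_commute)
  qed
  have incr: "\<phi>' 0 < \<phi>' s" if "0 < s" for s
    using pd d0 that D2 unfolding positive_definite_def by (intro DERIV_pos_imp_increasing[OF that]) blast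
  obtain \<xi> where \<xi>: "0 < \<xi>" "\<phi> 1 - \<phi> 0 = (1 - 0) * \<phi>' \<xi>"
    using MVT2[of 0 1 \<phi> \<phi>'] D1 by auto
  with incr[OF \<xi>(1)] show ?thesis
    by (simp add: \<phi>_def \<phi>'_def d_def)
qed

text \<open>On the unit sphere about \<open>m\<close> the least value \<open>V p\<close> exceeds
  \<open>V m\<close>. Convexity along rays from \<open>m\<close> then forces \<open>V\<close> to
  grow outside the sphere at least linearly, at rate \<open>V p - V m\<close>.\<close>

lemma bounded_sublevel_if_strict_minimum:
  fixes V :: "'a::euclidean_space \<Rightarrow> real"
  assumes cont: "continuous_on UNIV V"
    and above: "\<And>x z. x \<noteq> z \<Longrightarrow> V z + G z \<bullet> (x - z) < V x"
    and min: "\<And>x. V m \<le> V x"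
  shows "bounded {x. V x \<le> c}"
proof -
  have "continuous_on (sphere m 1) V" by (rule continuous_on_subset[OF cont]) simp
  moreover have "sphere m 1 \<noteq> {}" by simp
  ultimately obtain p where p: "p \<in> sphere m 1" "\<And>x. x \<in> sphere m 1 \<Longrightarrow> V p \<le> V x"
    using continuous_attains_inf[OF compact_sphere] by metis
  have "V m < V p"
  proof -
    \<comment> \<open>Adding the tangent inequalities at the midpoint cancels the linear terms and
      leaves \<open>2 * V ?q < V p + V m\<close>; moreover \<open>V m \<le> V ?q\<close>.\<close>
    let ?q = "(1/2) *\<^sub>R (p + m)"
    have "p \<noteq> m" using p(1) by auto
    have "2 *\<^sub>R (p - ?q) = p - m" "2 *\<^sub>R (m - ?q) = m - p"
      by (simp_all add: scaleR_diff_right scaleR_2)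
    with \<open>p \<noteq> m\<close> have "p \<noteq> ?q" "m \<noteq> ?q" by force+
    from above[OF this(1)] above[OF this(2)]
    have "2 * V ?q + G ?q \<bullet> (p - ?q + (m - ?q)) < V p + V m"
      by (simp add: inner_add_right)
    moreover have "p - ?q + (m - ?q) = 0"
      by (simp add: algebra_simps flip: scaleR_left_distrib)
    ultimately show ?thesis using min[of ?q] by simp
  qed
  have growth: "V p - V m \<le> (V x - V m) / norm (x - m)" if "1 \<le> norm (x - m)" for x
  proof -
    let ?R = "norm (x - m)"
    \<comment> \<open>The point where the ray from \<open>m\<close> to \<open>x\<close> meets the
      unit sphere. It is the convex combination of \<open>x\<close> and \<open>m\<close> with
      weights \<open>1 / ?R\<close> and \<open>1 - 1 / ?R\<close>; with these weights the linear
      terms of the tangent at \<open>?z\<close> cancel.\<close>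
    let ?z = "m + (1 / ?R) *\<^sub>R (x - m)"
    have weak: "V z + G z \<bullet> (x - z) \<le> V x" for x z
      using above[of x z] by (cases "x = z") auto
    have xz: "x - ?z = (1 - 1 / ?R) *\<^sub>R (x - m)" and mz: "m - ?z = - (1 / ?R) *\<^sub>R (x - m)"
      by (simp_all add: algebra_simps)
    have tangents: "a = t * (a + g \<bullet> ((1 - t) *\<^sub>R d)) + (1 - t) * (a + g \<bullet> (- t *\<^sub>R d))"
      for a t :: real and g d :: 'a
      by (simp add: algebra_simps)
    have "V p \<le> V ?z"
      using that by (intro p(2)) (auto simp: dist_norm)
    also have "\<dots> = 1 / ?R * (V ?z + G ?z \<bullet> (x - ?z)) + (1 - 1 / ?R) * (V ?z + G ?z \<bullet> (m - ?z))"
      unfolding xz mz by (rule tangents)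
    also have "\<dots> \<le> 1 / ?R * V x + (1 - 1 / ?R) * V m"
      using that by (intro add_mono mult_left_mono weak) (auto simp: divide_le_eq_1 simp del: norm_le_zero_iff zero_less_norm_iff)
    finally show ?thesis by (simp add: algebra_simps diff_divide_distrib)
  qed
  show ?thesis
  proof (rule bounded_subset)
    show "bounded (cball m (max 1 ((c - V m) / (V p - V m))))" by simp
    show "{x. V x \<le> c} \<subseteq> cball m (max 1 ((c - V m) / (V p - V m)))"
    proof clarify
      fix x assume x: "V x \<le> c"
      show "x \<in> cball m (max 1 ((c - V m) / (V p - V m)))"
      proof (cases "1 \<le> norm (x - m)")
        case True
        then have "0 < norm (x - m)" by linarith
        then have "(V p - V m) * norm (x - m) \<le> V x - V m"
          using growth[OF True] by (simp only: pos_le_divide_eq)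
        then have "(V p - V m) * norm (x - m) \<le> c - V m" using x by linarith
        then show ?thesis
          using \<open>V m < V p\<close> by (simp add: pos_le_divide_eq dist_norm norm_minus_commute mult.commute le_max_iff_disj)
      qed (simp add: dist_norm norm_minus_commute)
    qed
  qed
qed

text \<open>Divide the convexity inequality on the segment from \<open>z\<close> to \<open>x\<close>
  by \<theta> and let \<theta> tend to 0 from the right: the quotient tends to the directional
  derivative and the factor \<open>1 - \<theta>\<close> to 1.\<close>

lemma strongly_convex_above_tangent:
  fixes V :: "'a::real_inner \<Rightarrow> real"
  assumes "strongly_convex V"
  obtains \<mu> where "\<mu> > 0" "\<And>x z g. (V has_derivative (\<lambda>h. g \<bullet> h)) (at z) \<Longrightarrow>
    V z + g \<bullet> (x - z) + \<mu> / 2 * (norm (x - z))\<^sup>2 \<le> V x"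
proof -
  obtain \<mu> where \<mu>: "\<mu> > 0" and sc: "\<And>x y \<theta>. \<theta> \<in> {0..1} \<Longrightarrow> V (\<theta> *\<^sub>R x + (1 - \<theta>) *\<^sub>R y)
       \<le> \<theta> * V x + (1 - \<theta>) * V y - \<mu> / 2 * \<theta> * (1 - \<theta>) * (norm (x - y))\<^sup>2"
    using assms unfolding strongly_convex_def by blast
  have "V z + g \<bullet> (x - z) + \<mu> / 2 * (norm (x - z))\<^sup>2 \<le> V x"
    if V: "(V has_derivative (\<lambda>h. g \<bullet> h)) (at z)" for x z g
  proof -
    let ?\<phi> = "\<lambda>\<theta>. V (z + \<theta> *\<^sub>R (x - z))"
    have "((\<lambda>\<theta>. z + \<theta> *\<^sub>R (x - z)) has_derivative (\<lambda>h. h *\<^sub>R (x - z))) (at (0::real))"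
      by (auto intro!: derivative_eq_intros)
    from has_derivative_compose[OF this, of V "\<lambda>h. g \<bullet> h"] V
    have "(?\<phi> has_real_derivative g \<bullet> (x - z)) (at 0)"
      unfolding has_field_derivative_def
      by (auto intro: has_derivative_eq_rhs simp: fun_eq_iff)
    then have "((\<lambda>\<theta>. (?\<phi> \<theta> - V z) / \<theta>) \<longlongrightarrow> g \<bullet> (x - z)) (at_right 0)"
      unfolding has_field_derivative_iff by (auto intro: tendsto_within_subset)
    moreover have "((\<lambda>\<theta>. V x - V z - \<mu> / 2 * (1 - \<theta>) * (norm (x - z))\<^sup>2)
        \<longlongrightarrow> V x - V z - \<mu> / 2 * (1 - 0) * (norm (x - z))\<^sup>2) (at_right 0)"
      by (intro tendsto_intros)
    moreover have "\<forall>\<^sub>F \<theta> in at_right 0. (?\<phi> \<theta> - V z) / \<theta> \<le> V x - V z - \<mu> / 2 * (1 - \<theta>) * (norm (x - z))\<^sup>2"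
    proof -
      have "\<forall>\<^sub>F \<theta> in at_right (0::real). \<theta> \<in> {0<..<1}"
        by (rule eventually_at_right_real) simp
      then show ?thesis
      proof (rule eventually_mono)
        fix \<theta> :: real assume \<theta>: "\<theta> \<in> {0<..<1}"
        have "z + \<theta> *\<^sub>R (x - z) = \<theta> *\<^sub>R x + (1 - \<theta>) *\<^sub>R z" by (simp add: algebra_simps)
        then have "?\<phi> \<theta> - V z \<le> (V x - V z - \<mu> / 2 * (1 - \<theta>) * (norm (x - z))\<^sup>2) * \<theta>"
          using sc[of \<theta> x z] \<theta> by (simp add: algebra_simps)
        then show "(?\<phi> \<theta> - V z) / \<theta> \<le> V x - V z - \<mu> / 2 * (1 - \<theta>) * (norm (x - z))\<^sup>2"
          using \<theta> by (simp add: pos_divide_le_eq)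
      qed
    qed
    ultimately have "g \<bullet> (x - z) \<le> V x - V z - \<mu> / 2 * (1 - 0) * (norm (x - z))\<^sup>2"
      by (intro tendsto_le[OF trivial_limit_at_right_real])
    then show ?thesis by simp
  qed
  with \<mu> show thesis by (rule that)
qed

lemma bounded_sublevel_if_above_paraboloid:
  fixes V :: "'a::real_inner \<Rightarrow> real"
  assumes "\<mu> > 0" and V: "\<And>x. V 0 + g \<bullet> x + \<mu> / 2 * (norm x)\<^sup>2 \<le> V x"
  shows "bounded {x. V x \<le> c}"
  unfolding bounded_iff
proof (intro exI ballI)
  let ?C = "\<bar>c - V 0\<bar> + norm g"
  fix x assume "x \<in> {x. V x \<le> c}"
  then have x: "V x \<le> c" by simp
  show "norm x \<le> max 1 (2 * ?C / \<mu>)"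
  proof (cases "1 \<le> norm x")
    case True
    have "- (norm g * norm x) \<le> g \<bullet> x"
      using Cauchy_Schwarz_ineq2[of g x] by linarith
    then have "\<mu> / 2 * (norm x)\<^sup>2 \<le> c - V 0 + norm g * norm x"
      using V[of x] x by linarith
    \<comment> \<open>For \<open>1 \<le> norm x\<close> the constant is absorbed into a multiple of
      \<open>norm x\<close>, so that one factor \<open>norm x\<close> can be cancelled from the
      quadratic bound.\<close>
    also have "\<dots> \<le> \<bar>c - V 0\<bar> * 1 + norm g * norm x"
      by simp
    also have "\<dots> \<le> \<bar>c - V 0\<bar> * norm x + norm g * norm x"
      using True by (intro add_right_mono mult_left_mono) auto
    finally have "(\<mu> / 2 * norm x) * norm x \<le> ?C * norm x"
      by (simp add: power2_eq_square algebra_simps)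
    then have "\<mu> / 2 * norm x \<le> ?C"
      by (rule mult_right_le_imp_le) (use True in linarith)
    then have "norm x \<le> 2 * ?C / \<mu>"
      using \<open>\<mu> > 0\<close> by (simp add: field_simps)
    then show ?thesis by simp
  qed simp
qed

subsection \<open>Convergence under coordinatewise descent\<close>

text \<open>The common core of both claims: the two convexity hypotheses enter only through
  \<open>above\<close> and \<open>bdd\<close>.\<close>

theorem coordinatewise_descent_converges:
  fixes V :: "real ^ 'n::finite \<Rightarrow> real" and y :: "real \<Rightarrow> real ^ 'n"
  assumes AC: "absolutely_continuous_trajectory y"
    and V: "\<And>x. (V has_derivative (\<lambda>h. G x \<bullet> h)) (at x)" and G: "continuous_on UNIV G"
    and above: "\<And>x z. x \<noteq> z \<Longrightarrow> V z + G z \<bullet> (x - z) < V x"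
    and bdd: "\<And>c. bounded {x. V x \<le> c}"
    and descent: "\<And>t y' i. t > 0 \<Longrightarrow> (y has_vector_derivative y') (at t) \<Longrightarrow> y' $ i * G (y t) $ i \<le> 0"
  shows "\<exists>l. (y \<longlongrightarrow> l) at_top"
proof -
  have AC': "absolutely_continuous_on {a..b} y" if "0 \<le> a" for a b
  proof (rule absolutely_continuous_on_subset)
    show "absolutely_continuous_on {0..max 0 b} y"
      using AC unfolding absolutely_continuous_trajectory_def by simp
  qed (use that in auto)
  have contV: "continuous_on UNIV V"
    using V by (meson continuous_at_imp_continuous_on has_derivative_continuous)
  have V_decr: "V (y b) \<le> V (y a)" if "0 \<le> a" "a \<le> b" for a b
  proof (rule absolutely_continuous_decreasing_along[OF that(2) AC'[OF that(1)] V G])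
    show "G (y t) \<bullet> y' \<le> 0" if "a < t" "t < b" "(y has_vector_derivative y') (at t)" for t y'
      unfolding inner_vec_def using descent[OF _ that(3)] that \<open>0 \<le> a\<close>
      by (intro sum_nonpos) (simp add: mult.commute)
  qed
  have "bounded (range (\<lambda>n. y (real n)))"
    by (rule bounded_subset[OF bdd[of "V (y 0)"]]) (use V_decr in auto)
  then obtain l \<rho> where \<rho>: "strict_mono (\<rho> :: nat \<Rightarrow> nat)" and lim: "(\<lambda>n. y (real (\<rho> n))) \<longlonglongrightarrow> l"
    using bounded_imp_convergent_subsequence[of "\<lambda>n. y (real n)"] by (auto simp: o_def)
  have V_ge: "V l \<le> V (y t)" if "0 \<le> t" for t
  proof (rule tendsto_upperbound)
    show "(\<lambda>n. V (y (real (\<rho> n)))) \<longlonglongrightarrow> V l"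
      by (rule continuous_on_tendsto_compose[OF contV lim]) auto
    show "\<forall>\<^sub>F n in sequentially. V (y (real (\<rho> n))) \<le> V (y t)"
      using eventually_ge_at_top[of "nat \<lceil>t\<rceil>"]
    proof (rule eventually_mono)
      fix n assume "nat \<lceil>t\<rceil> \<le> n"
      then have "t \<le> real (\<rho> n)" using seq_suble[OF \<rho>, of n] by linarith
      then show "V (y (real (\<rho> n))) \<le> V (y t)" using V_decr that by simp
    qed
  qed simp
  have "(y \<longlongrightarrow> l) at_top"
  proof (rule tendstoI)
    fix e :: real assume "e > 0"
    \<comment> \<open>The factor one half is what makes \<open>2 * G x $ i - G l $ i\<close> keep
      the sign of \<open>G l $ i\<close>, which is then also the sign of
      \<open>G x $ i\<close>.\<close>
    have "\<forall>\<^sub>F x in nhds l. \<forall>i. G l $ i \<noteq> 0 \<longrightarrow> \<bar>G x $ i - G l $ i\<bar> < \<bar>G l $ i\<bar> / 2"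
    proof (rule eventually_all_finite)
      fix i
      have "((\<lambda>x. G x $ i) \<longlongrightarrow> G l $ i) (nhds l)"
        using G by (intro tendsto_vec_nth) (simp add: continuous_on_eq_continuous_at isCont_def tendsto_nhds_iff)
      then show "\<forall>\<^sub>F x in nhds l. G l $ i \<noteq> 0 \<longrightarrow> \<bar>G x $ i - G l $ i\<bar> < \<bar>G l $ i\<bar> / 2"
        using tendstoD[of "\<lambda>x. G x $ i" "G l $ i" "nhds l" "\<bar>G l $ i\<bar> / 2"]
        by (cases "G l $ i = 0") (auto simp: dist_real_def)
    qed
    then obtain r0 where r0: "r0 > 0" and near: "\<And>x i. dist x l < r0 \<Longrightarrow> G l $ i \<noteq> 0 \<Longrightarrow>
        \<bar>G x $ i - G l $ i\<bar> < \<bar>G l $ i\<bar> / 2"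
      unfolding eventually_nhds_metric by blast
    define r where "r = min r0 e"
    have r: "r > 0" "r \<le> r0" "r \<le> e" using r0 \<open>e > 0\<close> by (auto simp: r_def)
    \<comment> \<open>Up to a constant, \<open>h\<close> is the height of \<open>V\<close> above its
      tangent plane at \<open>l\<close>, so it is strictly least at \<open>l\<close>.\<close>
    define h where "h x = V x - G l \<bullet> x" for x
    have conth: "continuous_on A h" for A
      unfolding h_def by (intro continuous_intros continuous_on_subset[OF contV]) auto
    have "sphere l r \<noteq> {}" using r(1) by simp
    then obtain p where p: "p \<in> sphere l r" "\<And>x. x \<in> sphere l r \<Longrightarrow> h p \<le> h x"
      using continuous_attains_inf[OF compact_sphere _ conth] by metis
    have "p \<noteq> l" using p(1) r(1) by auto
    from above[OF this] have hp: "h l < h p" by (simp add: h_def inner_diff_right)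
    define L where "L x = V x + h x" for x
    have L: "(L has_derivative (\<lambda>d. (2 *\<^sub>R G x - G l) \<bullet> d)) (at x)" for x
      unfolding L_def h_def
      by (auto intro!: derivative_eq_intros V simp: inner_diff_left)
    \<comment> \<open>The threshold \<open>V l + h p\<close> lies above
      \<open>L l = V l + h l\<close>. At any point of the curve on the sphere,
      \<open>V \<ge> V l\<close> and \<open>h \<ge> h p\<close> give \<open>L\<close> at least this
      value.\<close>
    have "\<forall>\<^sub>F n in sequentially. L (y (real (\<rho> n))) < V l + h p"
    proof (rule order_tendstoD(2))
      show "(\<lambda>n. L (y (real (\<rho> n)))) \<longlonglongrightarrow> L l"
        unfolding L_def
        by (intro tendsto_add continuous_on_tendsto_compose[OF contV lim]
            continuous_on_tendsto_compose[OF conth[of UNIV] lim]) auto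
    qed (use hp in \<open>simp add: L_def\<close>)
    moreover have "\<forall>\<^sub>F n in sequentially. dist (y (real (\<rho> n))) l < r"
      using lim r(1) by (rule tendstoD)
    ultimately have "\<forall>\<^sub>F n in sequentially. L (y (real (\<rho> n))) < V l + h p \<and> dist (y (real (\<rho> n))) l < r"
      by (rule eventually_conj)
    from eventually_happens'[OF sequentially_bot this]
    obtain n where "L (y (real (\<rho> n))) < V l + h p \<and> dist (y (real (\<rho> n))) l < r" ..
    then obtain t0 :: real where t0: "0 \<le> t0" "L (y t0) < V l + h p" "dist (y t0) l < r"
      by (intro that[of "real (\<rho> n)"]) auto
    have trapped: "dist (y t) l < r" if "t0 \<le> t" for t
    proof (rule ccontr)
      assume far: "\<not> dist (y t) l < r"
      have conty: "continuous_on {t0..b} (\<lambda>s. dist (y s) l)" for b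
        using absolutely_continuous_on_imp_continuous_on[OF AC'[OF t0(1)]]
        by (intro continuous_intros)
      \<comment> \<open>The least element \<open>s1\<close> of this compact set is the first exit
        time. Up to it the curve stays in the ball, where \<open>L\<close> cannot increase, and at
        \<open>s1\<close> the distance is exactly \<open>r\<close> by the intermediate value
        theorem.\<close>
      let ?A = "{t0..t} \<inter> (\<lambda>s. dist (y s) l) -` {r..}"
      have compactA: "compact ?A"
        unfolding compact_eq_bounded_closed
        by (intro conjI continuous_closed_preimage[OF conty]) (auto intro: bounded_Int)
      have "?A \<noteq> {}" using far that by auto
      from compact_attains_inf[OF compactA this]
      obtain s1 where s1: "s1 \<in> ?A" and s1_le: "\<forall>s\<in>?A. s1 \<le> s" ..
      have inside: "dist (y s) l < r" if "t0 \<le> s" "s < s1" for s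
      proof (rule ccontr)
        assume "\<not> dist (y s) l < r"
        then have "s \<in> ?A" using s1 that by auto
        from bspec[OF s1_le this] show False using that by simp
      qed
      have "\<exists>s\<ge>t0. s \<le> s1 \<and> dist (y s) l = r"
        using s1 t0(3) by (intro IVT' conty) auto
      then have s1_r: "dist (y s1) l = r"
        using inside by (metis order_less_le)
      have "L (y s1) \<le> L (y t0)"
      proof (rule absolutely_continuous_decreasing_along[OF _ AC'[OF t0(1)] L])
        show "continuous_on UNIV (\<lambda>x. 2 *\<^sub>R G x - G l)"
          using G by (intro continuous_intros)
        fix s y' assume s: "t0 < s" "s < s1" "(y has_vector_derivative y') (at s)"
        have "(2 * G (y s) $ i - G l $ i) * y' $ i \<le> 0" for i
        proof -
          have prod: "y' $ i * G (y s) $ i \<le> 0"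
            using descent[OF _ s(3)] s(1) t0(1) by simp
          have "G l $ i = 0 \<or> \<bar>G (y s) $ i - G l $ i\<bar> < \<bar>G l $ i\<bar> / 2"
            using near[of "y s" i] inside[of s] s r(2) by fastforce
          then show ?thesis
            using prod by (auto simp: mult_le_0_iff abs_if split: if_splits)
        qed
        then show "(2 *\<^sub>R G (y s) - G l) \<bullet> y' \<le> 0"
          unfolding inner_vec_def by (intro sum_nonpos) simp
      qed (use s1 in auto)
      moreover have "h p \<le> h (y s1)"
        using s1_r by (intro p(2)) (simp add: dist_commute)
      moreover have "V l \<le> V (y s1)"
        using s1 t0(1) by (intro V_ge) auto
      ultimately show False
        using t0(2) unfolding L_def by linarith
    qed
    show "\<forall>\<^sub>F t in at_top. dist (y t) l < e"
      using eventually_ge_at_top[of t0]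
      by (rule eventually_mono) (use trapped r(3) in fastforce)
  qed
  then show ?thesis ..
qed

theorem corollary3:
  fixes V :: "real ^ 'n::finite \<Rightarrow> real"
    and y :: "real \<Rightarrow> real ^ 'n"
  assumes "twice_differentiable V"
    and "locally_lipschitz (hessian V)"
    and "absolutely_continuous_trajectory y"
    and "\<And>t y' i. t \<ge> 0 \<Longrightarrow> (y has_vector_derivative y') (at t within {0..}) \<Longrightarrow>
           y' $ i * partial_derivative i V (y t) \<le> 0"
  shows "((\<forall>x. positive_definite (hessian V x)) \<and> (\<exists>x_min. \<forall>x. V x_min \<le> V x)
            \<longrightarrow> (\<exists>l. (y \<longlongrightarrow> l) at_top))
       \<and> (strongly_convex V \<longrightarrow> (\<exists>l. (y \<longlongrightarrow> l) at_top))"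
proof -
  have V: "(V has_derivative (\<lambda>h. gradient V x \<bullet> h)) (at x)" for x
    using assms(1) by (intro has_derivative_gradient) (simp add: twice_differentiable_def)
  have contV: "continuous_on UNIV V"
    using V by (meson continuous_at_imp_continuous_on has_derivative_continuous)
  have G: "continuous_on UNIV (gradient V)"
    using assms(1) unfolding twice_differentiable_def
    by (intro continuous_at_imp_continuous_on ballI differentiable_imp_continuous_within) simp
  have descent: "y' $ i * gradient V (y t) $ i \<le> 0"
    if "t > 0" "(y has_vector_derivative y') (at t)" for t y' i
    using assms(4)[of t y' i] that by (simp add: gradient_def has_vector_derivative_at_within)
  note converges = coordinatewise_descent_converges[OF assms(3) V G _ _ descent]
  show ?thesis
  proof (intro conjI impI)
    assume "(\<forall>x. positive_definite (hessian V x)) \<and> (\<exists>x_min. \<forall>x. V x_min \<le> V x)"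
    then obtain m where pd: "\<And>x. positive_definite (hessian V x)" and m: "\<And>x. V m \<le> V x" by blast
    note above = above_tangent_if_hessian_positive_definite[OF assms(1) pd]
    show "\<exists>l. (y \<longlongrightarrow> l) at_top"
      using above bounded_sublevel_if_strict_minimum[OF contV above m] by (rule converges)
  next
    assume "strongly_convex V"
    then obtain \<mu> where \<mu>: "\<mu> > 0"
      \<comment> \<open>The quadratic term supplies both requirements of the core theorem:
        strictness off the point of tangency and, taken at the origin, bounded sublevel
        sets.\<close>
      and above: "\<And>x z. V z + gradient V z \<bullet> (x - z) + \<mu> / 2 * (norm (x - z))\<^sup>2 \<le> V x"
      using strongly_convex_above_tangent V by metis
    show "\<exists>l. (y \<longlongrightarrow> l) at_top"
    proof (rule converges)
      show "V z + gradient V z \<bullet> (x - z) < V x" if "x \<noteq> z" for x z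
      proof -
        have "0 < \<mu> / 2 * (norm (x - z))\<^sup>2" using \<mu> that by simp
        then show ?thesis using above[of z x] by linarith
      qed
      show "bounded {x. V x \<le> c}" for c
        using above[of 0] by (intro bounded_sublevel_if_above_paraboloid[OF \<mu>, where g = "gradient V 0"]) simp
    qed
  qed
qed

end
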